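(* Let $(\mathcal C,\circ,I,\sigma)$ be a braided monoidal category. For any bimonoid $H=(H,m_H,u_H,\Delta_H,\varepsilon_H)$ in $\mathcal C$ (equivalently, any object of $\mathrm{Bimon}(\mathcal C,\circ,\circ)$), the following conditions are equivalent: (1) $H$ is a Hopf monoid in the braided monoidal category $(\mathcal C,\circ,I,\sigma)$; (2) $H$ is a Hopf monoid in the duoidal category with reversion $(\mathcal C,\circ,I,\circ,I)$ associated with $(\mathcal C,\circ,I,\sigma)$; (3) the Galois maps $\varkappa^H_{P,X,Q}:=(\mu_P\circ X\circ Q)(P\circ\sigma_{X,H}\circ Q)(P\circ X\circ\rho_Q):P\circ X\circ Q\to P\circ X\circ Q$ are invertible, for any object $X$ in $\mathcal C$, right $H$-module $(P,\mu_P)$ and left $H$-comodule $(Q,\rho_Q)$; (4) the co-Galois maps $\varsigma^H_{P,X,Q}:=(P\circ X\circ\mu_Q)(P\circ\sigma_{H,X}\circ Q)(\rho_P\circ X\circ Q):P\circ X\circ Q\to P\circ X\circ Q$ are invertible, for any object $X$, right $H$-comodule $(P,\rho_P)$ and left $H$-module $(Q,\mu_Q)$; (5) $g_r$ is an isomorphism in $\mathcal C$ for any morphism $g:H\to A$ of monoids in $\mathcal C$; (6) $g^r$ is an isomorphism in $\mathcal C$ for any morphism $g:C\to H$ of comonoids in $\mathcal C$; (7) the fusion morphism $(\mathrm{Id}_H)_r$ is invertible; (8) the fusion morphism $(\mathrm{Id}_H)^r$ is invertible. As a consequence, the category $\mathrm{Hopf}(\mathcal C,\circ,\circ)$ of Hopf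 monoids in the duoidal category $(\mathcal C,\circ,I,\circ,I)$ is the category $\mathrm{Hopf}(\mathcal C)$ of Hopf monoids in the braided monoidal category $\mathcal C$.
   Context: Composition is juxtaposition (right to left), an object also denotes its identity, associativity constraints are suppressed; $l,r$ are the unit constraints of $(\mathcal C,\circ,I)$. A braided monoidal category $(\mathcal C,\circ,I,\sigma)$ is regarded as a duoidal category $(\mathcal C,\circ,I,\bullet,J)$ with $\bullet=\circ$, $J=I$, interchange law $\zeta_{A,B,C,D}=A\circ\sigma_{B,C}\circ D:A\circ B\circ C\circ D\to A\circ C\circ B\circ D$, $\Delta_I=(l_I)^{-1}$, $m_I=l_I$, $\varepsilon_I=\mathrm{Id}_I$. Bimonoids in this duoidal category are the usual bimonoids in the braided category. The reversion on it is given by the identity functor ($X^-=X$) with $\phi^\circ_{X,Y}=\phi^\bullet_{X,Y}=\sigma_{X,Y}$, $\phi^\circ_0=\phi^\bullet_0=\mathrm{Id}_I$, $\gamma_{X,Y,Z,T}=\delta_{X,Y,Z,T}=X\circ\sigma_{Y,Z}\circ T$, $\widetilde\gamma_{X,Y,Z,T}=\sigma_{X\circ Y,Z}\circ T$, $\widetilde\delta_{X,Y,Z,T}=X\circ\sigma_{Y,Z\circ T}$. A Hopf monoid in this duoidal category with reversion is a bimonoid $H$ for which there is a morphism $\Sigma_H:H\to H$ in $\mathcal C$ with $(m_H\circ I\circ I)\varphi_{H,H}(H\circ\Sigma_H)\Delta_H=(u_H\circ I\circ I)(\Delta_I\circ I)(l_I)^{-1}\varepsilon_H$ and $(I\circ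 I\circ m_H)\psi_{H,H}(\Sigma_H\circ H)\Delta_H=(I\circ I\circ u_H)(I\circ\Delta_I)(r_I)^{-1}\varepsilon_H$, where $\varphi_{X,Y}=(X\circ\sigma_{I,Y}\circ I)(X\circ I\circ r_Y^{-1})(X\circ l_Y^{-1}):X\circ Y\to X\circ Y\circ I\circ I$ and $\psi_{X,Y}=(I\circ\sigma_{X,I}\circ Y)(l_X^{-1}\circ I\circ Y)(r_X^{-1}\circ Y):X\circ Y\to I\circ I\circ X\circ Y$. $\mathrm{Hopf}(\mathcal C,\circ,\circ)$ is the full subcategory of bimonoids given by these. A Hopf monoid in the braided monoidal category is a bimonoid $H$ with $S_H:H\to H$ such that $m_H(H\circ S_H)\Delta_H=u_H\varepsilon_H=m_H(S_H\circ H)\Delta_H$. For a morphism of monoids $g:H\to A$: $g_r:=m_{A\circ H}\big((A\circ u_H)\circ(g\circ H)\Delta_H\big):(A\circ I)\circ H\to A\circ H$, with $m_{A\circ H}=(m_A\circ m_H)(A\circ\sigma_{H,A}\circ H)$. For a morphism of comonoids $g:C\to H$: $g^r:=\big((C\circ\varepsilon_H)\circ m_H(g\circ H)\big)\Delta_{C\circ H}:C\circ H\to(C\circ I)\circ H$, with $\Delta_{C\circ H}=(C\circ\sigma_{C,H}\circ H)(\Delta_C\circ\Delta_H)$. *)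

theory Defs
  imports Main
begin

section \<open>Categories\<close>

record ('o, 'a) cat =
  Obj :: "'o set"
  Arr :: "'a set"
  Dom :: "'a \<Rightarrow> 'o"
  Cod :: "'a \<Rightarrow> 'o"
  ident :: "'o \<Rightarrow> 'a" ("\<one>\<index>")
  comp :: "'a \<Rightarrow> 'a \<Rightarrow> 'a" (infixl "\<cdot>\<index>" 55)

definition hom :: "('o, 'a, 'z) cat_scheme \<Rightarrow> 'o \<Rightarrow> 'o \<Rightarrow> 'a set"
  where "hom C A B = {f \<in> Arr C. Dom C f = A \<and> Cod C f = B}"

definition inverse_arrows :: "('o, 'a, 'z) cat_scheme \<Rightarrow> 'a \<Rightarrow> 'a \<Rightarrow> bool"
  where "inverse_arrows C f g \<longleftrightarrow>
    f \<in> Arr C \<and> g \<in> hom C (Cod C f) (Dom C f) \<and>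
    g \<cdot>\<^bsub>C\<^esub> f = \<one>\<^bsub>C\<^esub> (Dom C f) \<and> f \<cdot>\<^bsub>C\<^esub> g = \<one>\<^bsub>C\<^esub> (Cod C f)"

definition iso :: "('o, 'a, 'z) cat_scheme \<Rightarrow> 'a \<Rightarrow> bool"
  where "iso C f \<longleftrightarrow> (\<exists>g. inverse_arrows C f g)"

definition inv_arr :: "('o, 'a, 'z) cat_scheme \<Rightarrow> 'a \<Rightarrow> 'a" ("inv\<index>")
  where "inv_arr C f = (THE g. inverse_arrows C f g)"

locale category =
  fixes C :: "('o, 'a, 'z) cat_scheme" (structure)
  assumes Dom_Obj: "f \<in> Arr C \<Longrightarrow> Dom C f \<in> Obj C"
    and Cod_Obj: "f \<in> Arr C \<Longrightarrow> Cod C f \<in> Obj C"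
    and ident_hom: "A \<in> Obj C \<Longrightarrow> \<one> A \<in> hom C A A"
    and comp_hom: "\<lbrakk>f \<in> hom C A B; g \<in> hom C B D\<rbrakk> \<Longrightarrow> g \<cdot> f \<in> hom C A D"
    and comp_ident_left: "f \<in> hom C A B \<Longrightarrow> \<one> B \<cdot> f = f"
    and comp_ident_right: "f \<in> hom C A B \<Longrightarrow> f \<cdot> \<one> A = f"
    and comp_assoc: "\<lbrakk>f \<in> hom C A B; g \<in> hom C B D; h \<in> hom C D E\<rbrakk>
      \<Longrightarrow> h \<cdot> (g \<cdot> f) = h \<cdot> g \<cdot> f"

definition full_subcategory ::
    "('o, 'a) cat \<Rightarrow> ('o \<Rightarrow> bool) \<Rightarrow> ('o, 'a) cat"
  where "full_subcategory C P =
    C\<lparr>Obj := {A \<in> Obj C. P A}, Arr := {f \<in> Arr C. P (Dom C f) \<and> P (Cod C f)}\<rparr>"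


section \<open>Braided monoidal categories\<close>

text \<open>
  The tensor product of arrows is written \<open>\<boxtimes>\<close>.  The associator
  \<open>\<alpha> A B D : (A \<otimes> B) \<otimes> D \<rightarrow> A \<otimes> (B \<otimes> D)\<close> is not assumed to be an identity, so
  that every formula below carries the associators that are usually suppressed.
\<close>

record ('o, 'a) moncat = "('o, 'a) cat" +
  tensor_obj :: "'o \<Rightarrow> 'o \<Rightarrow> 'o" (infixl "\<otimes>\<index>" 70)
  tensor_arr :: "'a \<Rightarrow> 'a \<Rightarrow> 'a" (infixl "\<boxtimes>\<index>" 70)
  unit_obj :: "'o" ("\<I>\<index>")
  associator :: "'o \<Rightarrow> 'o \<Rightarrow> 'o \<Rightarrow> 'a" ("\<alpha>\<index>")
  lunit :: "'o \<Rightarrow> 'a" ("\<l>\<index>")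
  runit :: "'o \<Rightarrow> 'a" ("\<r>\<index>")

locale monoidal_category = category C
  for C :: "('o, 'a, 'z) moncat_scheme" (structure) +
  assumes tensor_Obj: "\<lbrakk>A \<in> Obj C; B \<in> Obj C\<rbrakk> \<Longrightarrow> A \<otimes> B \<in> Obj C"
    and tensor_hom: "\<lbrakk>f \<in> hom C A B; g \<in> hom C A' B'\<rbrakk>
      \<Longrightarrow> f \<boxtimes> g \<in> hom C (A \<otimes> A') (B \<otimes> B')"
    and tensor_ident: "\<lbrakk>A \<in> Obj C; B \<in> Obj C\<rbrakk> \<Longrightarrow> \<one> A \<boxtimes> \<one> B = \<one> (A \<otimes> B)"
    and tensor_comp:
      "\<lbrakk>f \<in> hom C A B; g \<in> hom C B D; f' \<in> hom C A' B'; g' \<in> hom C B' D'\<rbrakk>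
      \<Longrightarrow> (g \<cdot> f) \<boxtimes> (g' \<cdot> f') = (g \<boxtimes> g') \<cdot> (f \<boxtimes> f')"
    and unit_Obj: "\<I> \<in> Obj C"
    and associator_hom: "\<lbrakk>A \<in> Obj C; B \<in> Obj C; D \<in> Obj C\<rbrakk>
      \<Longrightarrow> \<alpha> A B D \<in> hom C ((A \<otimes> B) \<otimes> D) (A \<otimes> (B \<otimes> D))"
    and associator_iso: "\<lbrakk>A \<in> Obj C; B \<in> Obj C; D \<in> Obj C\<rbrakk> \<Longrightarrow> iso C (\<alpha> A B D)"
    and associator_natural:
      "\<lbrakk>f \<in> hom C A A'; g \<in> hom C B B'; h \<in> hom C D D'\<rbrakk>
      \<Longrightarrow> \<alpha> A' B' D' \<cdot> ((f \<boxtimes> g) \<boxtimes> h) = (f \<boxtimes> (g \<boxtimes> h)) \<cdot> \<alpha> A B D"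
    and lunit_hom: "A \<in> Obj C \<Longrightarrow> \<l> A \<in> hom C (\<I> \<otimes> A) A"
    and lunit_iso: "A \<in> Obj C \<Longrightarrow> iso C (\<l> A)"
    and lunit_natural: "f \<in> hom C A B \<Longrightarrow> \<l> B \<cdot> (\<one> \<I> \<boxtimes> f) = f \<cdot> \<l> A"
    and runit_hom: "A \<in> Obj C \<Longrightarrow> \<r> A \<in> hom C (A \<otimes> \<I>) A"
    and runit_iso: "A \<in> Obj C \<Longrightarrow> iso C (\<r> A)"
    and runit_natural: "f \<in> hom C A B \<Longrightarrow> \<r> B \<cdot> (f \<boxtimes> \<one> \<I>) = f \<cdot> \<r> A"
    and pentagon: "\<lbrakk>A \<in> Obj C; B \<in> Obj C; D \<in> Obj C; E \<in> Obj C\<rbrakk>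
      \<Longrightarrow> (\<one> A \<boxtimes> \<alpha> B D E) \<cdot> \<alpha> A (B \<otimes> D) E \<cdot> (\<alpha> A B D \<boxtimes> \<one> E)
        = \<alpha> A B (D \<otimes> E) \<cdot> \<alpha> (A \<otimes> B) D E"
    and triangle: "\<lbrakk>A \<in> Obj C; B \<in> Obj C\<rbrakk>
      \<Longrightarrow> (\<one> A \<boxtimes> \<l> B) \<cdot> \<alpha> A \<I> B = \<r> A \<boxtimes> \<one> B"

record ('o, 'a) braidcat = "('o, 'a) moncat" +
  braiding :: "'o \<Rightarrow> 'o \<Rightarrow> 'a" ("\<sigma>\<index>")

locale braided_monoidal_category = monoidal_category C
  for C :: "('o, 'a) braidcat" (structure) +
  assumes braiding_hom: "\<lbrakk>A \<in> Obj C; B \<in> Obj C\<rbrakk> \<Longrightarrow> \<sigma> A B \<in> hom C (A \<otimes> B) (B \<otimes> A)"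
    and braiding_iso: "\<lbrakk>A \<in> Obj C; B \<in> Obj C\<rbrakk> \<Longrightarrow> iso C (\<sigma> A B)"
    and braiding_natural: "\<lbrakk>f \<in> hom C A A'; g \<in> hom C B B'\<rbrakk>
      \<Longrightarrow> \<sigma> A' B' \<cdot> (f \<boxtimes> g) = (g \<boxtimes> f) \<cdot> \<sigma> A B"
    and hexagon1: "\<lbrakk>A \<in> Obj C; B \<in> Obj C; D \<in> Obj C\<rbrakk>
      \<Longrightarrow> \<alpha> B D A \<cdot> \<sigma> A (B \<otimes> D) \<cdot> \<alpha> A B D
        = (\<one> B \<boxtimes> \<sigma> A D) \<cdot> \<alpha> B A D \<cdot> (\<sigma> A B \<boxtimes> \<one> D)"
    and hexagon2: "\<lbrakk>A \<in> Obj C; B \<in> Obj C; D \<in> Obj C\<rbrakk>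
      \<Longrightarrow> inv (\<alpha> D A B) \<cdot> \<sigma> (A \<otimes> B) D \<cdot> inv (\<alpha> A B D)
        = (\<sigma> A D \<boxtimes> \<one> B) \<cdot> inv (\<alpha> A D B) \<cdot> (\<one> A \<boxtimes> \<sigma> B D)"


section \<open>Monoids, comonoids, bimonoids\<close>

context
  fixes C :: "('o, 'a) braidcat" (structure)
begin

text \<open>
  The arrow \<open>A \<circ> \<sigma>\<^sub>B\<^sub>,\<^sub>D \<circ> E\<close>, bracketed as
  \<open>(A \<otimes> B) \<otimes> (D \<otimes> E) \<rightarrow> (A \<otimes> D) \<otimes> (B \<otimes> E)\<close>; it is the interchange law of the
  associated duoidal category.  Whenever the middle factors of a four-fold product are
  braided below, this arrow is used.
\<close>

definition interchange :: "'o \<Rightarrow> 'o \<Rightarrow> 'o \<Rightarrow> 'o \<Rightarrow> 'a" ("\<zeta>")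
  where "\<zeta> A B D E =
    inv (\<alpha> A D (B \<otimes> E)) \<cdot> (\<one> A \<boxtimes> \<alpha> D B E) \<cdot> (\<one> A \<boxtimes> (\<sigma> B D \<boxtimes> \<one> E)) \<cdot>
    (\<one> A \<boxtimes> inv (\<alpha> B D E)) \<cdot> \<alpha> A B (D \<otimes> E)"

text \<open>The structure arrows \<open>\<Delta>\<^sub>I\<close>, \<open>m\<^sub>I\<close>, \<open>\<epsilon>\<^sub>I\<close> of the associated duoidal category.\<close>

definition \<Delta>\<^sub>I :: "'a" where "\<Delta>\<^sub>I = inv (\<l> \<I>)"
definition m\<^sub>I :: "'a" where "m\<^sub>I = \<l> \<I>"
definition \<epsilon>\<^sub>I :: "'a" where "\<epsilon>\<^sub>I = \<one> \<I>"

fun monoid :: "'o \<times> 'a \<times> 'a \<Rightarrow> bool"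
  where "monoid (A, m, u) \<longleftrightarrow>
    A \<in> Obj C \<and> m \<in> hom C (A \<otimes> A) A \<and> u \<in> hom C \<I> A \<and>
    m \<cdot> (m \<boxtimes> \<one> A) = m \<cdot> (\<one> A \<boxtimes> m) \<cdot> \<alpha> A A A \<and>
    m \<cdot> (u \<boxtimes> \<one> A) = \<l> A \<and>
    m \<cdot> (\<one> A \<boxtimes> u) = \<r> A"

fun monoid_hom :: "'o \<times> 'a \<times> 'a \<Rightarrow> 'o \<times> 'a \<times> 'a \<Rightarrow> 'a \<Rightarrow> bool"
  where "monoid_hom (A, m, u) (A', m', u') g \<longleftrightarrow>
    g \<in> hom C A A' \<and> g \<cdot> m = m' \<cdot> (g \<boxtimes> g) \<and> g \<cdot> u = u'"

fun comonoid :: "'o \<times> 'a \<times> 'a \<Rightarrow> bool"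
  where "comonoid (D, \<Delta>, \<epsilon>) \<longleftrightarrow>
    D \<in> Obj C \<and> \<Delta> \<in> hom C D (D \<otimes> D) \<and> \<epsilon> \<in> hom C D \<I> \<and>
    \<alpha> D D D \<cdot> (\<Delta> \<boxtimes> \<one> D) \<cdot> \<Delta> = (\<one> D \<boxtimes> \<Delta>) \<cdot> \<Delta> \<and>
    (\<epsilon> \<boxtimes> \<one> D) \<cdot> \<Delta> = inv (\<l> D) \<and>
    (\<one> D \<boxtimes> \<epsilon>) \<cdot> \<Delta> = inv (\<r> D)"

fun comonoid_hom :: "'o \<times> 'a \<times> 'a \<Rightarrow> 'o \<times> 'a \<times> 'a \<Rightarrow> 'a \<Rightarrow> bool"
  where "comonoid_hom (D, \<Delta>, \<epsilon>) (D', \<Delta>', \<epsilon>') g \<longleftrightarrow>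
    g \<in> hom C D D' \<and> \<Delta>' \<cdot> g = (g \<boxtimes> g) \<cdot> \<Delta> \<and> \<epsilon>' \<cdot> g = \<epsilon>"

text \<open>
  The axioms are written with the duoidal structure arrows, so that the usual bimonoids of the braided
  category and the bimonoids of the associated duoidal category are given by literally
  the same axioms.
\<close>

fun bimonoid :: "'o \<times> 'a \<times> 'a \<times> 'a \<times> 'a \<Rightarrow> bool"
  where "bimonoid (H, m, u, \<Delta>, \<epsilon>) \<longleftrightarrow>
    monoid (H, m, u) \<and> comonoid (H, \<Delta>, \<epsilon>) \<and>
    \<Delta> \<cdot> m = (m \<boxtimes> m) \<cdot> \<zeta> H H H H \<cdot> (\<Delta> \<boxtimes> \<Delta>) \<and>
    \<Delta> \<cdot> u = (u \<boxtimes> u) \<cdot> \<Delta>\<^sub>I \<and>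
    \<epsilon> \<cdot> m = m\<^sub>I \<cdot> (\<epsilon> \<boxtimes> \<epsilon>) \<and>
    \<epsilon> \<cdot> u = \<epsilon>\<^sub>I"

fun bimonoid_hom ::
    "'o \<times> 'a \<times> 'a \<times> 'a \<times> 'a \<Rightarrow> 'o \<times> 'a \<times> 'a \<times> 'a \<times> 'a \<Rightarrow> 'a \<Rightarrow> bool"
  where "bimonoid_hom (H, m, u, \<Delta>, \<epsilon>) (H', m', u', \<Delta>', \<epsilon>') f \<longleftrightarrow>
    monoid_hom (H, m, u) (H', m', u') f \<and> comonoid_hom (H, \<Delta>, \<epsilon>) (H', \<Delta>', \<epsilon>') f"

text \<open>An arrow of the category of bimonoids records its source and target bimonoid.\<close>

definition Bimon ::
  "('o \<times> 'a \<times> 'a \<times> 'a \<times> 'a,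
    ('o \<times> 'a \<times> 'a \<times> 'a \<times> 'a) \<times> 'a \<times> ('o \<times> 'a \<times> 'a \<times> 'a \<times> 'a)) cat"
  where "Bimon =
    \<lparr>Obj = {H. bimonoid H},
     Arr = {(H, f, K). bimonoid H \<and> bimonoid K \<and> bimonoid_hom H K f},
     Dom = (\<lambda>(H, f, K). H),
     Cod = (\<lambda>(H, f, K). K),
     ident = (\<lambda>H. (H, \<one> (fst H), H)),
     comp = (\<lambda>(K', g, L) (H, f, K). (H, g \<cdot> f, L))\<rparr>"


section \<open>Modules and comodules\<close>

fun right_module :: "'o \<times> 'a \<times> 'a \<Rightarrow> 'o \<times> 'a \<Rightarrow> bool"
  where "right_module (H, m, u) (P, \<mu>) \<longleftrightarrow>
    P \<in> Obj C \<and> \<mu> \<in> hom C (P \<otimes> H) P \<and>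
    \<mu> \<cdot> (\<mu> \<boxtimes> \<one> H) = \<mu> \<cdot> (\<one> P \<boxtimes> m) \<cdot> \<alpha> P H H \<and>
    \<mu> \<cdot> (\<one> P \<boxtimes> u) = \<r> P"

fun left_module :: "'o \<times> 'a \<times> 'a \<Rightarrow> 'o \<times> 'a \<Rightarrow> bool"
  where "left_module (H, m, u) (Q, \<mu>) \<longleftrightarrow>
    Q \<in> Obj C \<and> \<mu> \<in> hom C (H \<otimes> Q) Q \<and>
    \<mu> \<cdot> (m \<boxtimes> \<one> Q) = \<mu> \<cdot> (\<one> H \<boxtimes> \<mu>) \<cdot> \<alpha> H H Q \<and>
    \<mu> \<cdot> (u \<boxtimes> \<one> Q) = \<l> Q"

fun right_comodule :: "'o \<times> 'a \<times> 'a \<Rightarrow> 'o \<times> 'a \<Rightarrow> bool"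
  where "right_comodule (H, \<Delta>, \<epsilon>) (P, \<rho>) \<longleftrightarrow>
    P \<in> Obj C \<and> \<rho> \<in> hom C P (P \<otimes> H) \<and>
    \<alpha> P H H \<cdot> (\<rho> \<boxtimes> \<one> H) \<cdot> \<rho> = (\<one> P \<boxtimes> \<Delta>) \<cdot> \<rho> \<and>
    (\<one> P \<boxtimes> \<epsilon>) \<cdot> \<rho> = inv (\<r> P)"

fun left_comodule :: "'o \<times> 'a \<times> 'a \<Rightarrow> 'o \<times> 'a \<Rightarrow> bool"
  where "left_comodule (H, \<Delta>, \<epsilon>) (Q, \<rho>) \<longleftrightarrow>
    Q \<in> Obj C \<and> \<rho> \<in> hom C Q (H \<otimes> Q) \<and>
    \<alpha> H H Q \<cdot> (\<Delta> \<boxtimes> \<one> Q) \<cdot> \<rho> = (\<one> H \<boxtimes> \<rho>) \<cdot> \<rho> \<and>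
    (\<epsilon> \<boxtimes> \<one> Q) \<cdot> \<rho> = inv (\<l> Q)"


section \<open>Hopf monoids\<close>

fun hopf_monoid_braided :: "'o \<times> 'a \<times> 'a \<times> 'a \<times> 'a \<Rightarrow> bool"
  where "hopf_monoid_braided (H, m, u, \<Delta>, \<epsilon>) \<longleftrightarrow>
    bimonoid (H, m, u, \<Delta>, \<epsilon>) \<and>
    (\<exists>S \<in> hom C H H.
      m \<cdot> (\<one> H \<boxtimes> S) \<cdot> \<Delta> = u \<cdot> \<epsilon> \<and>
      m \<cdot> (S \<boxtimes> \<one> H) \<cdot> \<Delta> = u \<cdot> \<epsilon>)"

definition \<phi> :: "'o \<Rightarrow> 'o \<Rightarrow> 'a" \<comment> \<open>\<open>X \<otimes> Y \<rightarrow> (X \<otimes> Y) \<otimes> (I \<otimes> I)\<close>\<close>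
  where "\<phi> X Y =
    \<zeta> X \<I> Y \<I> \<cdot> inv (\<alpha> X \<I> (Y \<otimes> \<I>)) \<cdot>
    (\<one> X \<boxtimes> (\<one> \<I> \<boxtimes> inv (\<r> Y))) \<cdot> (\<one> X \<boxtimes> inv (\<l> Y))"

definition \<psi> :: "'o \<Rightarrow> 'o \<Rightarrow> 'a" \<comment> \<open>\<open>X \<otimes> Y \<rightarrow> (I \<otimes> I) \<otimes> (X \<otimes> Y)\<close>\<close>
  where "\<psi> X Y =
    \<zeta> \<I> X \<I> Y \<cdot> \<alpha> (\<I> \<otimes> X) \<I> Y \<cdot>
    ((inv (\<l> X) \<boxtimes> \<one> \<I>) \<boxtimes> \<one> Y) \<cdot> (inv (\<r> X) \<boxtimes> \<one> Y)"

fun hopf_monoid_duoidal :: "'o \<times> 'a \<times> 'a \<times> 'a \<times> 'a \<Rightarrow> bool"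
  where "hopf_monoid_duoidal (H, m, u, \<Delta>, \<epsilon>) \<longleftrightarrow>
    bimonoid (H, m, u, \<Delta>, \<epsilon>) \<and>
    (\<exists>\<Sigma> \<in> hom C H H.
      (m \<boxtimes> \<one> (\<I> \<otimes> \<I>)) \<cdot> \<phi> H H \<cdot> (\<one> H \<boxtimes> \<Sigma>) \<cdot> \<Delta>
        = (u \<boxtimes> \<one> (\<I> \<otimes> \<I>)) \<cdot> \<alpha> \<I> \<I> \<I> \<cdot> (\<Delta>\<^sub>I \<boxtimes> \<one> \<I>) \<cdot> inv (\<l> \<I>) \<cdot> \<epsilon> \<and>
      (\<one> (\<I> \<otimes> \<I>) \<boxtimes> m) \<cdot> \<psi> H H \<cdot> (\<Sigma> \<boxtimes> \<one> H) \<cdot> \<Delta>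
        = (\<one> (\<I> \<otimes> \<I>) \<boxtimes> u) \<cdot> inv (\<alpha> \<I> \<I> \<I>) \<cdot> (\<one> \<I> \<boxtimes> \<Delta>\<^sub>I) \<cdot> inv (\<r> \<I>) \<cdot> \<epsilon>)"

definition Hopf_braided where "Hopf_braided = full_subcategory Bimon hopf_monoid_braided"

definition Hopf_duoidal where "Hopf_duoidal = full_subcategory Bimon hopf_monoid_duoidal"


section \<open>Galois maps and fusion morphisms\<close>

text \<open>\<open>\<mu> : P \<otimes> H \<rightarrow> P\<close> and \<open>\<rho> : Q \<rightarrow> H \<otimes> Q\<close>; an endomorphism of \<open>(P \<otimes> X) \<otimes> Q\<close>.\<close>

fun galois_map :: "'o \<Rightarrow> 'o \<times> 'a \<Rightarrow> 'o \<Rightarrow> 'o \<times> 'a \<Rightarrow> 'a"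
  where "galois_map H (P, \<mu>) X (Q, \<rho>) =
    inv (\<alpha> P X Q) \<cdot> (\<mu> \<boxtimes> \<one> (X \<otimes> Q)) \<cdot> \<zeta> P X H Q \<cdot> (\<one> (P \<otimes> X) \<boxtimes> \<rho>)"

text \<open>\<open>\<rho> : P \<rightarrow> P \<otimes> H\<close> and \<open>\<mu> : H \<otimes> Q \<rightarrow> Q\<close>; an endomorphism of \<open>P \<otimes> (X \<otimes> Q)\<close>.\<close>

fun cogalois_map :: "'o \<Rightarrow> 'o \<times> 'a \<Rightarrow> 'o \<Rightarrow> 'o \<times> 'a \<Rightarrow> 'a"
  where "cogalois_map H (P, \<rho>) X (Q, \<mu>) =
    \<alpha> P X Q \<cdot> (\<one> (P \<otimes> X) \<boxtimes> \<mu>) \<cdot> \<zeta> P H X Q \<cdot> (\<rho> \<boxtimes> \<one> (X \<otimes> Q))"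

definition tensor_mult :: "'o \<Rightarrow> 'a \<Rightarrow> 'o \<Rightarrow> 'a \<Rightarrow> 'a"
  where "tensor_mult A m\<^sub>A H m\<^sub>H = (m\<^sub>A \<boxtimes> m\<^sub>H) \<cdot> \<zeta> A H A H"

definition tensor_comult :: "'o \<Rightarrow> 'a \<Rightarrow> 'o \<Rightarrow> 'a \<Rightarrow> 'a"
  where "tensor_comult D \<Delta>\<^sub>D H \<Delta>\<^sub>H = \<zeta> D D H H \<cdot> (\<Delta>\<^sub>D \<boxtimes> \<Delta>\<^sub>H)"

text \<open>\<open>g\<^sub>r : (A \<otimes> I) \<otimes> H \<rightarrow> A \<otimes> H\<close> for \<open>g : H \<rightarrow> A\<close>.\<close>

fun fusion_lower ::
    "'o \<times> 'a \<times> 'a \<times> 'a \<times> 'a \<Rightarrow> 'o \<times> 'a \<times> 'a \<Rightarrow> 'a \<Rightarrow> 'a"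
  where "fusion_lower (H, m, u, \<Delta>, \<epsilon>) (A, m\<^sub>A, u\<^sub>A) g =
    tensor_mult A m\<^sub>A H m \<cdot> ((\<one> A \<boxtimes> u) \<boxtimes> ((g \<boxtimes> \<one> H) \<cdot> \<Delta>))"

text \<open>\<open>g\<^sup>r : D \<otimes> H \<rightarrow> (D \<otimes> I) \<otimes> H\<close> for \<open>g : D \<rightarrow> H\<close>.\<close>

fun fusion_upper ::
    "'o \<times> 'a \<times> 'a \<times> 'a \<times> 'a \<Rightarrow> 'o \<times> 'a \<times> 'a \<Rightarrow> 'a \<Rightarrow> 'a"
  where "fusion_upper (H, m, u, \<Delta>, \<epsilon>) (D, \<Delta>\<^sub>D, \<epsilon>\<^sub>D) g =
    ((\<one> D \<boxtimes> \<epsilon>) \<boxtimes> (m \<cdot> (g \<boxtimes> \<one> H))) \<cdot> tensor_comult D \<Delta>\<^sub>D H \<Delta>"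

end

end

theory Submission
  imports Defs
begin

text \<open>
  For a monoid and comonoid \<open>H\<close>, a right module \<open>P\<close> and a left comodule \<open>Q\<close>, the convolution monoid
  \<open>hom H H\<close> acts (contravariantly) on \<open>P \<otimes> Q\<close>: an arrow \<open>f\<close> acts by coacting on \<open>Q\<close>, applying \<open>f\<close> to
  the new factor \<open>H\<close> and letting it act on \<open>P\<close>.  An antipode is a convolution inverse of the
  identity, so it makes the action \<open>\<kappa>\<^sub>P\<^sub>,\<^sub>Q\<close> of the identity invertible.  Conjugating with
  \<open>P \<otimes> \<sigma>\<^sub>X\<^sub>,\<^sub>Q\<close> turns the Galois map of \<open>P, X, Q\<close> into \<open>\<kappa>\<^sub>P\<^sub>,\<^sub>Q \<otimes> X\<close>, and the arrows \<open>g\<^sub>r\<close> are, up to a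
  unit constraint, the Galois maps for \<open>X = I\<close>, \<open>P = A\<close>, \<open>Q = H\<close>.

  Conversely, \<open>\<kappa>\<^sub>H\<^sub>,\<^sub>H\<close> is left \<open>H\<close>-linear and right \<open>H\<close>-colinear, hence so is its inverse, and every
  such endomorphism of \<open>H \<otimes> H\<close> is the action of a unique arrow \<open>S\<close>, which is then the antipode.
  The statements on co-Galois maps and on \<open>g\<^sup>r\<close> follow by passing to the opposite category.
\<close>

section \<open>Categories\<close>

context category
begin

text \<open>Typing is carried by the three separate facts on \<open>Arr\<close>, \<open>Dom\<close>
  and \<open>Cod\<close>, which the simplifier can compute from a term; membership in
  \<open>hom\<close> would require naming the intermediate objects of every composite.\<close>

lemma hom_iff: "f \<in> hom C A B \<longleftrightarrow> f \<in> Arr C \<and> Dom C f = A \<and> Cod C f = B"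
  by (simp add: hom_def)

lemma Dom_Cod_Obj [simp]:
  assumes "f \<in> Arr C"
  shows "Dom C f \<in> Obj C" "Cod C f \<in> Obj C"
  using assms by (auto intro: Dom_Obj Cod_Obj)

lemma ident_typing [simp]:
  assumes "A \<in> Obj C"
  shows "\<one> A \<in> Arr C" "Dom C (\<one> A) = A" "Cod C (\<one> A) = A"
  using ident_hom [OF assms] by (auto simp: hom_iff)

lemma comp_typing [simp]:
  assumes "f \<in> Arr C" "g \<in> Arr C" "Dom C g = Cod C f"
  shows "g \<cdot> f \<in> Arr C" "Dom C (g \<cdot> f) = Dom C f" "Cod C (g \<cdot> f) = Cod C g"
  using comp_hom [of f "Dom C f" "Cod C f" g "Cod C g"] assms by (auto simp: hom_iff)

text \<open>As a simp rule this fixes the normal form of composites: bracketed to the right. The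
  formulas in the definitions are bracketed to the left and are rebracketed by it on
  unfolding.\<close>

lemma assoc [simp]:
  assumes "f \<in> Arr C" "g \<in> Arr C" "h \<in> Arr C" "Dom C g = Cod C f" "Dom C h = Cod C g"
  shows "h \<cdot> g \<cdot> f = h \<cdot> (g \<cdot> f)"
  using comp_assoc [of f "Dom C f" "Cod C f" g "Cod C g" h "Cod C h"] assms
  by (simp add: hom_iff)

lemma ident_comp [simp]: "\<lbrakk>f \<in> Arr C; Cod C f = A\<rbrakk> \<Longrightarrow> \<one> A \<cdot> f = f"
  and comp_ident [simp]: "\<lbrakk>f \<in> Arr C; Dom C f = A\<rbrakk> \<Longrightarrow> f \<cdot> \<one> A = f"
  by (auto simp: hom_iff intro: comp_ident_left comp_ident_right)

text \<open>Lets an equation between composites act inside a longer one, where the normal form hides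
  the factor \<open>g \<cdot> f\<close>.\<close>

lemma reassoc:
  assumes "g \<cdot> f = k" "f \<in> Arr C" "g \<in> Arr C" "h \<in> Arr C" "Dom C g = Cod C f" "Dom C f = Cod C h"
  shows "g \<cdot> (f \<cdot> h) = k \<cdot> h"
  using assms assoc [of h f g] by simp

section \<open>Inverses and cancellation of isomorphisms\<close>

lemma inverse_arrows_iff:
  "inverse_arrows C f g \<longleftrightarrow> f \<in> Arr C \<and> g \<in> Arr C \<and> Dom C g = Cod C f \<and> Cod C g = Dom C f \<and>
    g \<cdot> f = \<one> (Dom C f) \<and> f \<cdot> g = \<one> (Cod C f)"
  by (auto simp: inverse_arrows_def hom_iff)

lemma inverse_arrows_sym: "inverse_arrows C f g \<longleftrightarrow> inverse_arrows C g f"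
  by (auto simp: inverse_arrows_iff)

text \<open>Justifies the definite description in \<open>inv_arr\<close>, by the usual evaluation of
  \<open>g \<cdot> f \<cdot> g'\<close> in two ways.\<close>

lemma inverse_unique:
  assumes "inverse_arrows C f g" "inverse_arrows C f g'"
  shows "g = g'"
proof -
  have "g \<cdot> (f \<cdot> g') = g'"
    using assms by (subst reassoc [where k = "\<one> (Dom C f)"]) (auto simp: inverse_arrows_iff)
  then show ?thesis
    using assms by (auto simp: inverse_arrows_iff)
qed

lemma inv_arr_eq: "inverse_arrows C f g \<Longrightarrow> inv f = g"
  unfolding inv_arr_def by (blast intro: inverse_unique)

lemma isoI: "inverse_arrows C f g \<Longrightarrow> iso C f"
  by (auto simp: iso_def)

lemma inverse_inv: "iso C f \<Longrightarrow> inverse_arrows C f (inv f)"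
  by (auto simp: iso_def inv_arr_eq)

lemma inv_typing [simp]:
  assumes "iso C f"
  shows "inv f \<in> Arr C" "Dom C (inv f) = Cod C f" "Cod C (inv f) = Dom C f"
    "inv f \<cdot> f = \<one> (Dom C f)" "f \<cdot> inv f = \<one> (Cod C f)"
  using inverse_inv [OF assms] by (auto simp: inverse_arrows_iff)

lemma iso_Arr: "iso C f \<Longrightarrow> f \<in> Arr C"
  by (auto simp: iso_def inverse_arrows_iff)

lemma inv_comp_cancel [simp]:
  assumes "iso C f"
  shows "\<lbrakk>h \<in> Arr C; Cod C h = Dom C f\<rbrakk> \<Longrightarrow> inv f \<cdot> (f \<cdot> h) = h"
    "\<lbrakk>h \<in> Arr C; Cod C h = Cod C f\<rbrakk> \<Longrightarrow> f \<cdot> (inv f \<cdot> h) = h"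
  using assms iso_Arr [OF assms]
  by (auto simp: reassoc [OF inv_typing(4)] reassoc [OF inv_typing(5)])

lemma iso_inv [simp]: "iso C f \<Longrightarrow> iso C (inv f)"
  and inv_inv [simp]: "iso C f \<Longrightarrow> inv (inv f) = f"
  using inverse_inv inverse_arrows_sym inv_arr_eq by (metis iso_def)+

lemma inverse_ident: "A \<in> Obj C \<Longrightarrow> inverse_arrows C (\<one> A) (\<one> A)"
  by (simp add: inverse_arrows_iff)

lemma inverse_comp:
  assumes f: "inverse_arrows C f f'" and g: "inverse_arrows C g g'" and "Dom C g = Cod C f"
  shows "inverse_arrows C (g \<cdot> f) (f' \<cdot> g')"
proof -
  have "iso C f" "iso C g" "f' = inv f" "g' = inv g"
    using f g inv_arr_eq by (auto simp: iso_def)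
  then show ?thesis
    using assms(3) by (simp add: inverse_arrows_iff iso_Arr)
qed

lemma iso_ident [simp]: "A \<in> Obj C \<Longrightarrow> iso C (\<one> A)"
  by (rule isoI [OF inverse_ident])

lemma inv_ident [simp]: "A \<in> Obj C \<Longrightarrow> inv (\<one> A) = \<one> A"
  by (rule inv_arr_eq [OF inverse_ident])

lemma iso_comp [simp]: "\<lbrakk>iso C f; iso C g; Dom C g = Cod C f\<rbrakk> \<Longrightarrow> iso C (g \<cdot> f)"
  and inv_comp: "\<lbrakk>iso C f; iso C g; Dom C g = Cod C f\<rbrakk> \<Longrightarrow> inv (g \<cdot> f) = inv f \<cdot> inv g"
  using inverse_comp [OF inverse_inv inverse_inv] isoI inv_arr_eq by metis+

lemma iso_comp_left_iff:
  assumes "iso C g" "f \<in> Arr C" "Dom C g = Cod C f"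
  shows "iso C (g \<cdot> f) \<longleftrightarrow> iso C f"
  using assms iso_comp [of "g \<cdot> f" "inv g"] by (auto simp: iso_Arr)

lemma iso_comp_right_iff:
  assumes "iso C f" "g \<in> Arr C" "Dom C g = Cod C f"
  shows "iso C (g \<cdot> f) \<longleftrightarrow> iso C g"
  using assms iso_comp [of "inv f" "g \<cdot> f"] by (auto simp: iso_Arr)

lemma cancel_left:
  assumes "g \<cdot> f = g \<cdot> f'" "iso C g" "f \<in> Arr C" "f' \<in> Arr C" "Cod C f = Dom C g" "Cod C f' = Dom C g"
  shows "f = f'"
  using assms by (metis inv_comp_cancel(1))

lemma cancel_right:
  assumes "f \<cdot> g = f' \<cdot> g" "iso C g" "f \<in> Arr C" "f' \<in> Arr C" "Dom C f = Cod C g" "Dom C f' = Cod C g"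
  shows "f = f'"
  using assms iso_Arr [OF assms(2)]
  by (metis assoc comp_ident inv_typing(1,2,3,5))

lemma comp_inv_eq_iff:
  assumes "iso C g" "f \<in> Arr C" "h \<in> Arr C" "Dom C h = Dom C g" "Dom C f = Cod C g"
  shows "h \<cdot> inv g = f \<longleftrightarrow> h = f \<cdot> g"
  using assms iso_Arr [OF assms(1)] by auto

lemma inv_comp_eq_iff:
  assumes "iso C g" "f \<in> Arr C" "h \<in> Arr C" "Cod C h = Cod C g" "Cod C f = Dom C g"
  shows "f = inv g \<cdot> h \<longleftrightarrow> g \<cdot> f = h"
  using assms by auto

text \<open>Compose the commuting square with \<open>inv a\<close> on one side and
  \<open>inv b\<close> on the other. This is how naturality, the pentagon, linearity and colinearity
  are passed on to inverses below.\<close>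

lemma inverse_square:
  assumes "a \<cdot> f = g \<cdot> b" and [simp]: "iso C a" "iso C b" "f \<in> Arr C" "g \<in> Arr C"
    "Dom C a = Cod C f" "Cod C a = Cod C g" "Dom C g = Cod C b" "Dom C f = Dom C b"
  shows "inv a \<cdot> g = f \<cdot> inv b"
proof -
  note [simp] = iso_Arr
  have "inv a \<cdot> g = inv a \<cdot> ((g \<cdot> b) \<cdot> inv b)"
    by simp
  also have "\<dots> = inv a \<cdot> ((a \<cdot> f) \<cdot> inv b)"
    by (simp only: assms(1))
  also have "\<dots> = f \<cdot> inv b"
    by simp
  finally show ?thesis .
qed

end

section \<open>Monoidal categories\<close>

context monoidal_category
begin

lemmas [simp] = tensor_Obj unit_Obj tensor_ident

lemma tensor_typing [simp]:
  assumes "f \<in> Arr C" "g \<in> Arr C"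
  shows "f \<boxtimes> g \<in> Arr C" "Dom C (f \<boxtimes> g) = Dom C f \<otimes> Dom C g" "Cod C (f \<boxtimes> g) = Cod C f \<otimes> Cod C g"
  using tensor_hom [of f _ _ g] assms by (auto simp: hom_iff)

lemma associator_typing [simp]:
  assumes "A \<in> Obj C" "B \<in> Obj C" "D \<in> Obj C"
  shows "\<alpha> A B D \<in> Arr C" "Dom C (\<alpha> A B D) = (A \<otimes> B) \<otimes> D" "Cod C (\<alpha> A B D) = A \<otimes> (B \<otimes> D)"
    "iso C (\<alpha> A B D)"
  using associator_hom [OF assms] associator_iso [OF assms] by (auto simp: hom_iff)

lemma unitor_typing [simp]:
  assumes "A \<in> Obj C"
  shows "\<l> A \<in> Arr C" "Dom C (\<l> A) = \<I> \<otimes> A" "Cod C (\<l> A) = A" "iso C (\<l> A)"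
    "\<r> A \<in> Arr C" "Dom C (\<r> A) = A \<otimes> \<I>" "Cod C (\<r> A) = A" "iso C (\<r> A)"
  using lunit_hom [OF assms] lunit_iso [OF assms] runit_hom [OF assms] runit_iso [OF assms]
  by (auto simp: hom_iff)

lemma interchange_law:
  assumes "f \<in> Arr C" "g \<in> Arr C" "f' \<in> Arr C" "g' \<in> Arr C" "Dom C g = Cod C f" "Dom C g' = Cod C f'"
  shows "(g \<boxtimes> g') \<cdot> (f \<boxtimes> f') = (g \<cdot> f) \<boxtimes> (g' \<cdot> f')"
  using tensor_comp [of f _ _ g _ f' _ _ g'] assms by (auto simp: hom_iff)

lemma interchange_law_reassoc:
  assumes "f \<in> Arr C" "g \<in> Arr C" "f' \<in> Arr C" "g' \<in> Arr C" "Dom C g = Cod C f" "Dom C g' = Cod C f'"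
    "h \<in> Arr C" "Cod C h = Dom C f \<otimes> Dom C f'"
  shows "(g \<boxtimes> g') \<cdot> ((f \<boxtimes> f') \<cdot> h) = ((g \<cdot> f) \<boxtimes> (g' \<cdot> f')) \<cdot> h"
  using assms by (intro reassoc interchange_law) auto

lemmas merge = interchange_law interchange_law_reassoc

lemma inverse_tensor:
  assumes "inverse_arrows C f f'" "inverse_arrows C g g'"
  shows "inverse_arrows C (f \<boxtimes> g) (f' \<boxtimes> g')"
  using assms by (auto simp: inverse_arrows_iff merge)

lemma iso_tensor [simp]: "\<lbrakk>iso C f; iso C g\<rbrakk> \<Longrightarrow> iso C (f \<boxtimes> g)"
  and inv_tensor: "\<lbrakk>iso C f; iso C g\<rbrakk> \<Longrightarrow> inv (f \<boxtimes> g) = inv f \<boxtimes> inv g"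
  using inverse_tensor [OF inverse_inv inverse_inv] isoI inv_arr_eq by metis+

lemma associator_nat:
  assumes "f \<in> Arr C" "g \<in> Arr C" "h \<in> Arr C"
  shows "\<alpha> (Cod C f) (Cod C g) (Cod C h) \<cdot> ((f \<boxtimes> g) \<boxtimes> h)
    = (f \<boxtimes> (g \<boxtimes> h)) \<cdot> \<alpha> (Dom C f) (Dom C g) (Dom C h)"
  using associator_natural [of f _ _ g _ _ h] assms by (auto simp: hom_iff)

lemma associator_inv_nat:
  assumes "f \<in> Arr C" "g \<in> Arr C" "h \<in> Arr C"
  shows "inv (\<alpha> (Cod C f) (Cod C g) (Cod C h)) \<cdot> (f \<boxtimes> (g \<boxtimes> h))
    = ((f \<boxtimes> g) \<boxtimes> h) \<cdot> inv (\<alpha> (Dom C f) (Dom C g) (Dom C h))"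
  by (rule inverse_square [OF associator_nat]) (auto simp: assms)

lemma lunit_nat: "f \<in> Arr C \<Longrightarrow> \<l> (Cod C f) \<cdot> (\<one> \<I> \<boxtimes> f) = f \<cdot> \<l> (Dom C f)"
  and runit_nat: "f \<in> Arr C \<Longrightarrow> \<r> (Cod C f) \<cdot> (f \<boxtimes> \<one> \<I>) = f \<cdot> \<r> (Dom C f)"
  by (auto simp: hom_iff intro: lunit_natural runit_natural)

lemma lunit_inv_nat: "f \<in> Arr C \<Longrightarrow> inv (\<l> (Cod C f)) \<cdot> f = (\<one> \<I> \<boxtimes> f) \<cdot> inv (\<l> (Dom C f))"
  and runit_inv_nat: "f \<in> Arr C \<Longrightarrow> inv (\<r> (Cod C f)) \<cdot> f = (f \<boxtimes> \<one> \<I>) \<cdot> inv (\<r> (Dom C f))"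
  by (auto intro!: inverse_square lunit_nat runit_nat)

text \<open>By naturality of the unit constraints, \<open>f\<close> is conjugate to
  \<open>\<one> \<I> \<boxtimes> f\<close> and to \<open>f \<boxtimes> \<one> \<I>\<close>.
  Identities between constraints can therefore be proved after tensoring with the unit, where the
  pentagon or a hexagon applies.\<close>

lemma tensor_unit_faithful:
  assumes "f \<in> Arr C" "g \<in> Arr C" "Dom C f = Dom C g" "Cod C f = Cod C g"
  shows "\<one> \<I> \<boxtimes> f = \<one> \<I> \<boxtimes> g \<Longrightarrow> f = g" "f \<boxtimes> \<one> \<I> = g \<boxtimes> \<one> \<I> \<Longrightarrow> f = g"
  using assms lunit_nat runit_nat
  by (metis cancel_right unitor_typing(3,4) Dom_Cod_Obj(1)) (metis assms lunit_nat runit_nat cancel_right unitor_typing(7,8) Dom_Cod_Obj(1))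

lemma iso_tensor_unit_iff:
  assumes "f \<in> Arr C"
  shows "iso C (f \<boxtimes> \<one> \<I>) \<longleftrightarrow> iso C f"
proof
  assume "iso C (f \<boxtimes> \<one> \<I>)"
  then have "iso C (f \<cdot> \<r> (Dom C f))"
    using assms runit_nat [OF assms, symmetric] by simp
  then show "iso C f"
    using assms by (simp add: iso_comp_right_iff)
qed simp

lemma triangle_mixed: "\<lbrakk>A \<in> Obj C; B \<in> Obj C\<rbrakk> \<Longrightarrow> (\<r> A \<boxtimes> \<one> B) \<cdot> inv (\<alpha> A \<I> B) = \<one> A \<boxtimes> \<l> B"
  by (simp add: triangle [symmetric])

section \<open>Coherence of the unit constraints, and pentagon and triangle with inverses\<close>

text \<open>Kelly's argument: tensored with \<I> on the left, the claim follows from the pentagon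
  for \<I>, \<I>, A, B, two instances of the triangle and naturality of the associator.\<close>

lemma lunit_tensor:
  assumes [simp]: "A \<in> Obj C" "B \<in> Obj C"
  shows "\<l> (A \<otimes> B) \<cdot> \<alpha> \<I> A B = \<l> A \<boxtimes> \<one> B"
proof (rule tensor_unit_faithful(1))
  \<comment> \<open>\<open>?k\<close> is the invertible part of that pentagon which is cancelled
    from the right at the end.\<close>
  let ?k = "\<alpha> \<I> (\<I> \<otimes> A) B \<cdot> (\<alpha> \<I> \<I> A \<boxtimes> \<one> B)"
  have "(\<one> \<I> \<boxtimes> (\<l> (A \<otimes> B) \<cdot> \<alpha> \<I> A B)) \<cdot> ?k
    = (\<one> \<I> \<boxtimes> \<l> (A \<otimes> B)) \<cdot> ((\<one> \<I> \<boxtimes> \<alpha> \<I> A B) \<cdot> \<alpha> \<I> (\<I> \<otimes> A) B \<cdot> (\<alpha> \<I> \<I> A \<boxtimes> \<one> B))"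
    by (simp add: merge)
  also have "\<dots> = ((\<one> \<I> \<boxtimes> \<l> (A \<otimes> B)) \<cdot> \<alpha> \<I> \<I> (A \<otimes> B)) \<cdot> \<alpha> (\<I> \<otimes> \<I>) A B"
    by (subst pentagon) auto
  also have "\<dots> = \<alpha> \<I> A B \<cdot> ((\<r> \<I> \<boxtimes> \<one> A) \<boxtimes> \<one> B)"
    using associator_nat [of "\<r> \<I>" "\<one> A" "\<one> B"] by (subst triangle) auto
  also have "\<dots> = \<alpha> \<I> A B \<cdot> ((\<one> \<I> \<boxtimes> \<l> A) \<boxtimes> \<one> B) \<cdot> (\<alpha> \<I> \<I> A \<boxtimes> \<one> B)"
    by (simp add: merge triangle [symmetric])
  also have "\<dots> = (\<one> \<I> \<boxtimes> (\<l> A \<boxtimes> \<one> B)) \<cdot> ?k"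
    using associator_nat [of "\<one> \<I>" "\<l> A" "\<one> B"]
    by (simp add: reassoc [OF associator_nat [of "\<one> \<I>" "\<l> A" "\<one> B", simplified]])
  finally show "\<one> \<I> \<boxtimes> (\<l> (A \<otimes> B) \<cdot> \<alpha> \<I> A B) = \<one> \<I> \<boxtimes> (\<l> A \<boxtimes> \<one> B)"
    by (rule cancel_right) auto
qed auto

text \<open>The mirror image of \<open>lunit_tensor\<close>: tensor with \<I> on the right and use
  the pentagon for A, B, \<I>, \<I>.\<close>

lemma runit_tensor:
  assumes [simp]: "A \<in> Obj C" "B \<in> Obj C"
  shows "(\<one> A \<boxtimes> \<r> B) \<cdot> \<alpha> A B \<I> = \<r> (A \<otimes> B)"
proof (rule tensor_unit_faithful(2))
  have "\<alpha> A B \<I> \<cdot> (((\<one> A \<boxtimes> \<r> B) \<cdot> \<alpha> A B \<I>) \<boxtimes> \<one> \<I>)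
    = (\<alpha> A B \<I> \<cdot> ((\<one> A \<boxtimes> \<r> B) \<boxtimes> \<one> \<I>)) \<cdot> (\<alpha> A B \<I> \<boxtimes> \<one> \<I>)"
    by (simp add: merge)
  also have "\<dots> = ((\<one> A \<boxtimes> (\<r> B \<boxtimes> \<one> \<I>)) \<cdot> \<alpha> A (B \<otimes> \<I>) \<I>) \<cdot> (\<alpha> A B \<I> \<boxtimes> \<one> \<I>)"
    using associator_nat [of "\<one> A" "\<r> B" "\<one> \<I>"] by simp
  also have "\<dots> = (\<one> A \<boxtimes> (\<one> B \<boxtimes> \<l> \<I>)) \<cdot> ((\<one> A \<boxtimes> \<alpha> B \<I> \<I>) \<cdot> \<alpha> A (B \<otimes> \<I>) \<I> \<cdot> (\<alpha> A B \<I> \<boxtimes> \<one> \<I>))"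
    by (simp add: merge triangle)
  also have "\<dots> = ((\<one> A \<boxtimes> (\<one> B \<boxtimes> \<l> \<I>)) \<cdot> \<alpha> A B (\<I> \<otimes> \<I>)) \<cdot> \<alpha> (A \<otimes> B) \<I> \<I>"
    by (subst pentagon) auto
  also have "\<dots> = (\<alpha> A B \<I> \<cdot> (\<one> (A \<otimes> B) \<boxtimes> \<l> \<I>)) \<cdot> \<alpha> (A \<otimes> B) \<I> \<I>"
    using associator_nat [of "\<one> A" "\<one> B" "\<l> \<I>"] by simp
  also have "\<dots> = \<alpha> A B \<I> \<cdot> (\<r> (A \<otimes> B) \<boxtimes> \<one> \<I>)"
    by (simp add: triangle)
  finally show "((\<one> A \<boxtimes> \<r> B) \<cdot> \<alpha> A B \<I>) \<boxtimes> \<one> \<I> = \<r> (A \<otimes> B) \<boxtimes> \<one> \<I>"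
    by (rule cancel_left) auto
qed auto

text \<open>Naturality of the left unit constraint at \<open>\<l> \<I>\<close> identifies
  \<open>\<l> (\<I> \<otimes> \<I>)\<close> with \<open>\<one> \<I> \<boxtimes> \<l> \<I>\<close>.
  Precomposed with the associator, the former becomes
  \<open>\<l> \<I> \<boxtimes> \<one> \<I>\<close> and the latter, by the triangle,
  \<open>\<r> \<I> \<boxtimes> \<one> \<I>\<close>.\<close>

lemma lunit_unit: "\<l> \<I> = \<r> \<I>"
proof (rule tensor_unit_faithful(2))
  have "\<l> (\<I> \<otimes> \<I>) = \<one> \<I> \<boxtimes> \<l> \<I>"
    by (rule cancel_left [where g = "\<l> \<I>"]) (use lunit_nat [of "\<l> \<I>"] in auto)
  then show "\<l> \<I> \<boxtimes> \<one> \<I> = \<r> \<I> \<boxtimes> \<one> \<I>"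
    by (simp add: lunit_tensor [symmetric] triangle [symmetric])
qed auto

lemma triangle_inverse_mixed: "\<lbrakk>A \<in> Obj C; B \<in> Obj C\<rbrakk> \<Longrightarrow> \<alpha> A \<I> B \<cdot> (inv (\<r> A) \<boxtimes> \<one> B) = \<one> A \<boxtimes> inv (\<l> B)"
  using arg_cong [OF triangle_mixed, of A B "inv_arr C"] by (simp add: inv_comp inv_tensor)

lemma lunit_inv_tensor: "\<lbrakk>A \<in> Obj C; B \<in> Obj C\<rbrakk> \<Longrightarrow> inv (\<alpha> \<I> A B) \<cdot> inv (\<l> (A \<otimes> B)) = inv (\<l> A) \<boxtimes> \<one> B"
  using arg_cong [OF lunit_tensor, of A B "inv_arr C"] by (simp add: inv_comp inv_tensor)

lemma runit_inv_tensor: "\<lbrakk>A \<in> Obj C; B \<in> Obj C\<rbrakk> \<Longrightarrow> inv (\<alpha> A B \<I>) \<cdot> (\<one> A \<boxtimes> inv (\<r> B)) = inv (\<r> (A \<otimes> B))"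
  using arg_cong [OF runit_tensor, of A B "inv_arr C"] by (simp add: inv_comp inv_tensor)

text \<open>The pentagon solved for a product of an inverse and a direct associator, the shape in
  which it occurs once coactions have been moved to the right and actions to the left.\<close>

lemma pentagon_mixed:
  assumes [simp]: "A \<in> Obj C" "B \<in> Obj C" "D \<in> Obj C" "E \<in> Obj C"
  shows "inv (\<alpha> A B (D \<otimes> E)) \<cdot> (\<one> A \<boxtimes> \<alpha> B D E)
    = \<alpha> (A \<otimes> B) D E \<cdot> ((inv (\<alpha> A B D) \<boxtimes> \<one> E) \<cdot> inv (\<alpha> A (B \<otimes> D) E))"
proof -
  let ?k = "\<alpha> A (B \<otimes> D) E \<cdot> (\<alpha> A B D \<boxtimes> \<one> E)"
  have "inv (\<alpha> A B (D \<otimes> E)) \<cdot> (\<one> A \<boxtimes> \<alpha> B D E) = \<alpha> (A \<otimes> B) D E \<cdot> inv ?k"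
    by (rule inverse_square) (use pentagon [OF assms] in auto)
  then show ?thesis
    by (simp add: inv_comp inv_tensor)
qed

lemma pentagon_inverse:
  assumes [simp]: "A \<in> Obj C" "B \<in> Obj C" "D \<in> Obj C" "E \<in> Obj C"
  shows "(inv (\<alpha> A B D) \<boxtimes> \<one> E) \<cdot> (inv (\<alpha> A (B \<otimes> D) E) \<cdot> (\<one> A \<boxtimes> inv (\<alpha> B D E)))
    = inv (\<alpha> (A \<otimes> B) D E) \<cdot> inv (\<alpha> A B (D \<otimes> E))"
  using arg_cong [OF pentagon [OF assms], of "inv_arr C"] by (simp add: inv_comp inv_tensor)

lemma pentagon_inverse_mixed:
  assumes [simp]: "A \<in> Obj C" "B \<in> Obj C" "D \<in> Obj C" "E \<in> Obj C"
  shows "(\<alpha> A B D \<boxtimes> \<one> E) \<cdot> (inv (\<alpha> (A \<otimes> B) D E) \<cdot> inv (\<alpha> A B (D \<otimes> E)))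
    = inv (\<alpha> A (B \<otimes> D) E) \<cdot> (\<one> A \<boxtimes> inv (\<alpha> B D E))"
  by (simp add: pentagon_inverse [symmetric] merge)

end

section \<open>Braidings\<close>

context braided_monoidal_category
begin

lemma braiding_typing [simp]:
  assumes "A \<in> Obj C" "B \<in> Obj C"
  shows "\<sigma> A B \<in> Arr C" "Dom C (\<sigma> A B) = A \<otimes> B" "Cod C (\<sigma> A B) = B \<otimes> A" "iso C (\<sigma> A B)"
  using braiding_hom [OF assms] braiding_iso [OF assms] by (auto simp: hom_iff)

lemma braiding_nat: "\<lbrakk>f \<in> Arr C; g \<in> Arr C\<rbrakk> \<Longrightarrow> \<sigma> (Cod C f) (Cod C g) \<cdot> (f \<boxtimes> g) = (g \<boxtimes> f) \<cdot> \<sigma> (Dom C f) (Dom C g)"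
  by (auto simp: hom_iff intro: braiding_natural)

section \<open>Braiding with the unit object\<close>

text \<open>Tensored with \<I> on the right, this is the first hexagon for A, \<I>, \<I>, read with
  naturality of the left unit constraint and of the braiding; the common factor
  \<open>\<sigma> A \<I>\<close> is then cancelled.\<close>

lemma lunit_braiding:
  assumes [simp]: "A \<in> Obj C"
  shows "\<l> A \<cdot> \<sigma> A \<I> = \<r> A"
proof (rule tensor_unit_faithful(2))
  have "\<sigma> A \<I> \<cdot> ((\<l> A \<cdot> \<sigma> A \<I>) \<boxtimes> \<one> \<I>) = (\<sigma> A \<I> \<cdot> (\<l> A \<boxtimes> \<one> \<I>)) \<cdot> (\<sigma> A \<I> \<boxtimes> \<one> \<I>)"
    by (simp add: merge)
  also have "\<dots> = (\<sigma> A \<I> \<cdot> \<l> (A \<otimes> \<I>)) \<cdot> \<alpha> \<I> A \<I> \<cdot> (\<sigma> A \<I> \<boxtimes> \<one> \<I>)"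
    by (simp add: lunit_tensor [symmetric])
  also have "\<dots> = \<l> (\<I> \<otimes> A) \<cdot> ((\<one> \<I> \<boxtimes> \<sigma> A \<I>) \<cdot> \<alpha> \<I> A \<I> \<cdot> (\<sigma> A \<I> \<boxtimes> \<one> \<I>))"
    using lunit_nat [of "\<sigma> A \<I>", symmetric] by simp
  also have "\<dots> = (\<l> (\<I> \<otimes> A) \<cdot> \<alpha> \<I> \<I> A) \<cdot> (\<sigma> A (\<I> \<otimes> \<I>) \<cdot> \<alpha> A \<I> \<I>)"
    by (subst hexagon1 [symmetric]) auto
  also have "\<dots> = ((\<l> \<I> \<boxtimes> \<one> A) \<cdot> \<sigma> A (\<I> \<otimes> \<I>)) \<cdot> \<alpha> A \<I> \<I>"
    by (simp add: lunit_tensor)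
  also have "\<dots> = (\<sigma> A \<I> \<cdot> (\<one> A \<boxtimes> \<l> \<I>)) \<cdot> \<alpha> A \<I> \<I>"
    using braiding_nat [of "\<one> A" "\<l> \<I>"] by simp
  also have "\<dots> = \<sigma> A \<I> \<cdot> (\<r> A \<boxtimes> \<one> \<I>)"
    by (simp add: triangle)
  finally show "(\<l> A \<cdot> \<sigma> A \<I>) \<boxtimes> \<one> \<I> = \<r> A \<boxtimes> \<one> \<I>"
    by (rule cancel_left) auto
qed auto

text \<open>The same argument with the second hexagon and \<I> tensored on the left.\<close>

lemma runit_braiding:
  assumes [simp]: "A \<in> Obj C"
  shows "\<r> A \<cdot> \<sigma> \<I> A = \<l> A"
proof (rule tensor_unit_faithful(1))
  have r: "\<r> (X \<otimes> Y) \<cdot> inv (\<alpha> X Y \<I>) = \<one> X \<boxtimes> \<r> Y" if "X \<in> Obj C" "Y \<in> Obj C" for X Y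
    using that by (simp add: runit_tensor [symmetric])
  have "\<sigma> \<I> A \<cdot> (\<one> \<I> \<boxtimes> (\<r> A \<cdot> \<sigma> \<I> A)) = (\<sigma> \<I> A \<cdot> (\<one> \<I> \<boxtimes> \<r> A)) \<cdot> (\<one> \<I> \<boxtimes> \<sigma> \<I> A)"
    by (simp add: merge)
  also have "\<dots> = (\<sigma> \<I> A \<cdot> \<r> (\<I> \<otimes> A)) \<cdot> inv (\<alpha> \<I> A \<I>) \<cdot> (\<one> \<I> \<boxtimes> \<sigma> \<I> A)"
    by (simp add: r [symmetric])
  also have "\<dots> = \<r> (A \<otimes> \<I>) \<cdot> ((\<sigma> \<I> A \<boxtimes> \<one> \<I>) \<cdot> inv (\<alpha> \<I> A \<I>) \<cdot> (\<one> \<I> \<boxtimes> \<sigma> \<I> A))"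
    using runit_nat [of "\<sigma> \<I> A", symmetric] by simp
  also have "\<dots> = (\<r> (A \<otimes> \<I>) \<cdot> inv (\<alpha> A \<I> \<I>)) \<cdot> (\<sigma> (\<I> \<otimes> \<I>) A \<cdot> inv (\<alpha> \<I> \<I> A))"
    by (subst hexagon2 [symmetric]) auto
  also have "\<dots> = ((\<one> A \<boxtimes> \<r> \<I>) \<cdot> \<sigma> (\<I> \<otimes> \<I>) A) \<cdot> inv (\<alpha> \<I> \<I> A)"
    by (simp add: r)
  also have "\<dots> = (\<sigma> \<I> A \<cdot> (\<r> \<I> \<boxtimes> \<one> A)) \<cdot> inv (\<alpha> \<I> \<I> A)"
    using braiding_nat [of "\<r> \<I>" "\<one> A"] by simp
  also have "\<dots> = \<sigma> \<I> A \<cdot> (\<one> \<I> \<boxtimes> \<l> A)"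
    by (simp add: triangle_mixed)
  finally show "\<one> \<I> \<boxtimes> (\<r> A \<cdot> \<sigma> \<I> A) = \<one> \<I> \<boxtimes> \<l> A"
    by (rule cancel_left) auto
qed auto

section \<open>The interchange law as an arrow\<close>

text \<open>Collects the braiding and its two associators into a single arrow on the last three
  factors, so that later computations can treat it apart from A.\<close>

lemma interchange_eq:
  assumes [simp]: "A \<in> Obj C" "B \<in> Obj C" "D \<in> Obj C" "E \<in> Obj C"
  shows "interchange C A B D E = inv (\<alpha> A D (B \<otimes> E)) \<cdot>
    ((\<one> A \<boxtimes> (\<alpha> D B E \<cdot> ((\<sigma> B D \<boxtimes> \<one> E) \<cdot> inv (\<alpha> B D E)))) \<cdot> \<alpha> A B (D \<otimes> E))"
  by (simp add: interchange_def merge)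

lemma interchange_typing [simp]:
  assumes [simp]: "A \<in> Obj C" "B \<in> Obj C" "D \<in> Obj C" "E \<in> Obj C"
  shows "interchange C A B D E \<in> Arr C"
    "Dom C (interchange C A B D E) = (A \<otimes> B) \<otimes> (D \<otimes> E)"
    "Cod C (interchange C A B D E) = (A \<otimes> D) \<otimes> (B \<otimes> E)"
  by (simp_all add: interchange_eq)

lemma interchange_nat:
  assumes [simp]: "a \<in> Arr C" "b \<in> Arr C" "d \<in> Arr C" "e \<in> Arr C"
  shows "interchange C (Cod C a) (Cod C b) (Cod C d) (Cod C e) \<cdot> ((a \<boxtimes> b) \<boxtimes> (d \<boxtimes> e))
    = ((a \<boxtimes> d) \<boxtimes> (b \<boxtimes> e)) \<cdot> interchange C (Dom C a) (Dom C b) (Dom C d) (Dom C e)"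
    (is "interchange C ?A' ?B' ?D' ?E' \<cdot> _ = _ \<cdot> interchange C ?A ?B ?D ?E")
proof -
  let ?mid = "\<lambda>B D E. \<alpha> D B E \<cdot> ((\<sigma> B D \<boxtimes> \<one> E) \<cdot> inv (\<alpha> B D E))"
  have mid: "?mid ?B' ?D' ?E' \<cdot> (b \<boxtimes> (d \<boxtimes> e)) = (d \<boxtimes> (b \<boxtimes> e)) \<cdot> ?mid ?B ?D ?E"
  proof -
    have "?mid ?B' ?D' ?E' \<cdot> (b \<boxtimes> (d \<boxtimes> e))
      = \<alpha> ?D' ?B' ?E' \<cdot> ((\<sigma> ?B' ?D' \<boxtimes> \<one> ?E') \<cdot> (inv (\<alpha> ?B' ?D' ?E') \<cdot> (b \<boxtimes> (d \<boxtimes> e))))"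
      by simp
    also have "\<dots> = \<alpha> ?D' ?B' ?E' \<cdot> (((\<sigma> ?B' ?D' \<cdot> (b \<boxtimes> d)) \<boxtimes> e) \<cdot> inv (\<alpha> ?B ?D ?E))"
      by (simp add: associator_inv_nat merge)
    also have "\<dots> = \<alpha> ?D' ?B' ?E' \<cdot> (((d \<boxtimes> b) \<boxtimes> e) \<cdot> ((\<sigma> ?B ?D \<boxtimes> \<one> ?E) \<cdot> inv (\<alpha> ?B ?D ?E)))"
      by (simp add: braiding_nat merge)
    also have "\<dots> = (d \<boxtimes> (b \<boxtimes> e)) \<cdot> ?mid ?B ?D ?E"
      by (simp add: reassoc [OF associator_nat])
    finally show ?thesis .
  qed
  have "interchange C ?A' ?B' ?D' ?E' \<cdot> ((a \<boxtimes> b) \<boxtimes> (d \<boxtimes> e))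
    = inv (\<alpha> ?A' ?D' (?B' \<otimes> ?E')) \<cdot>
      ((\<one> ?A' \<boxtimes> ?mid ?B' ?D' ?E') \<cdot> (\<alpha> ?A' ?B' (?D' \<otimes> ?E') \<cdot> ((a \<boxtimes> b) \<boxtimes> (d \<boxtimes> e))))"
    by (simp add: interchange_eq)
  also have "\<alpha> ?A' ?B' (?D' \<otimes> ?E') \<cdot> ((a \<boxtimes> b) \<boxtimes> (d \<boxtimes> e)) = (a \<boxtimes> (b \<boxtimes> (d \<boxtimes> e))) \<cdot> \<alpha> ?A ?B (?D \<otimes> ?E)"
    using associator_nat [of a b "d \<boxtimes> e"] by simp
  also have "(\<one> ?A' \<boxtimes> ?mid ?B' ?D' ?E') \<cdot> ((a \<boxtimes> (b \<boxtimes> (d \<boxtimes> e))) \<cdot> \<alpha> ?A ?B (?D \<otimes> ?E))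
      = (a \<boxtimes> (?mid ?B' ?D' ?E' \<cdot> (b \<boxtimes> (d \<boxtimes> e)))) \<cdot> \<alpha> ?A ?B (?D \<otimes> ?E)"
    by (simp add: merge)
  also have "\<dots> = (a \<boxtimes> (d \<boxtimes> (b \<boxtimes> e))) \<cdot> ((\<one> ?A \<boxtimes> ?mid ?B ?D ?E) \<cdot> \<alpha> ?A ?B (?D \<otimes> ?E))"
    by (subst mid) (simp add: merge)
  also have "inv (\<alpha> ?A' ?D' (?B' \<otimes> ?E')) \<cdot> \<dots> = ((a \<boxtimes> d) \<boxtimes> (b \<boxtimes> e)) \<cdot> interchange C ?A ?B ?D ?E"
    using associator_inv_nat [of a d "b \<boxtimes> e"]
    by (simp add: interchange_eq reassoc [OF associator_inv_nat [of a d "b \<boxtimes> e", simplified]])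
  finally show ?thesis .
qed

section \<open>Convolution and the Galois maps\<close>

definition conv :: "'a \<Rightarrow> 'a \<Rightarrow> 'a \<Rightarrow> 'a \<Rightarrow> 'a"
  where "conv m \<Delta> f g = m \<cdot> ((f \<boxtimes> g) \<cdot> \<Delta>)"

text \<open>At \<open>f = \<one> H\<close> this is the arrow \<kappa> of P and Q. The braiding does
  not occur in it, so everything about convolution takes place in the underlying monoidal
  category.\<close>

definition conv_action :: "'o \<Rightarrow> 'o \<Rightarrow> 'a \<Rightarrow> 'o \<Rightarrow> 'a \<Rightarrow> 'a \<Rightarrow> 'a"
  where "conv_action H P \<mu> Q \<rho> f = (\<mu> \<boxtimes> \<one> Q) \<cdot> (inv (\<alpha> P H Q) \<cdot> (\<one> P \<boxtimes> ((f \<boxtimes> \<one> Q) \<cdot> \<rho>)))"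

lemma conv_action_typing [simp]:
  assumes "H \<in> Obj C" "P \<in> Obj C" "Q \<in> Obj C" "\<mu> \<in> hom C (P \<otimes> H) P" "\<rho> \<in> hom C Q (H \<otimes> Q)"
    "f \<in> hom C H H"
  shows "conv_action H P \<mu> Q \<rho> f \<in> Arr C" "Dom C (conv_action H P \<mu> Q \<rho> f) = P \<otimes> Q"
    "Cod C (conv_action H P \<mu> Q \<rho> f) = P \<otimes> Q"
  using assms by (auto simp: conv_action_def hom_iff)

text \<open>In elements, \<open>g\<close> sends p and q to p g(h1) and q', then \<open>f\<close>
  gives (p g(h1)) f(h2). Coassociativity makes h1 and h2 the two legs of one element, and
  associativity of the action gathers g(h1) f(h2) into a convolution product. The arrow applied
  first takes the left leg, hence the reversed order.\<close>

lemma conv_action_mult: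
  assumes mod: "right_module C (H, m, u) (P, \<mu>)" and comod: "left_comodule C (H, \<Delta>, \<epsilon>) (Q, \<rho>)"
    and H [simp]: "H \<in> Obj C" and m: "m \<in> hom C (H \<otimes> H) H" and \<Delta>: "\<Delta> \<in> hom C H (H \<otimes> H)"
    and f: "f \<in> hom C H H" and g: "g \<in> hom C H H"
  shows "conv_action H P \<mu> Q \<rho> f \<cdot> conv_action H P \<mu> Q \<rho> g
    = conv_action H P \<mu> Q \<rho> (conv m \<Delta> g f)"
proof -
  have [simp]: "P \<in> Obj C" "Q \<in> Obj C" "\<mu> \<in> Arr C" "Dom C \<mu> = P \<otimes> H" "Cod C \<mu> = P"
    "\<rho> \<in> Arr C" "Dom C \<rho> = Q" "Cod C \<rho> = H \<otimes> Q" "m \<in> Arr C" "Dom C m = H \<otimes> H" "Cod C m = H"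
    "\<Delta> \<in> Arr C" "Dom C \<Delta> = H" "Cod C \<Delta> = H \<otimes> H" "f \<in> Arr C" "Dom C f = H" "Cod C f = H"
    "g \<in> Arr C" "Dom C g = H" "Cod C g = H"
    using mod comod m \<Delta> f g by (auto simp: hom_iff)
  have act: "\<mu> \<cdot> (\<mu> \<boxtimes> \<one> H) = \<mu> \<cdot> ((\<one> P \<boxtimes> m) \<cdot> \<alpha> P H H)"
    and coact: "(\<one> H \<boxtimes> \<rho>) \<cdot> \<rho> = \<alpha> H H Q \<cdot> ((\<Delta> \<boxtimes> \<one> Q) \<cdot> \<rho>)"
    using mod comod by auto
  let ?F = "(f \<boxtimes> \<one> Q) \<cdot> \<rho>" and ?G = "(g \<boxtimes> \<one> Q) \<cdot> \<rho>"
  have "(\<one> H \<boxtimes> ?F) \<cdot> ?G = (g \<boxtimes> (f \<boxtimes> \<one> Q)) \<cdot> ((\<one> H \<boxtimes> \<rho>) \<cdot> \<rho>)"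
    by (simp add: merge)
  also have "\<dots> = ((g \<boxtimes> (f \<boxtimes> \<one> Q)) \<cdot> \<alpha> H H Q) \<cdot> ((\<Delta> \<boxtimes> \<one> Q) \<cdot> \<rho>)"
    by (subst coact) simp
  also have "(g \<boxtimes> (f \<boxtimes> \<one> Q)) \<cdot> \<alpha> H H Q = \<alpha> H H Q \<cdot> ((g \<boxtimes> f) \<boxtimes> \<one> Q)"
    using associator_nat [of g f "\<one> Q"] by simp
  \<comment> \<open>The coaction half: two successive coactions have become one
    comultiplication.\<close>
  finally have FG: "(\<one> H \<boxtimes> ?F) \<cdot> ?G = \<alpha> H H Q \<cdot> ((((g \<boxtimes> f) \<cdot> \<Delta>) \<boxtimes> \<one> Q) \<cdot> \<rho>)"
    by (simp add: merge)
  have "conv_action H P \<mu> Q \<rho> f \<cdot> conv_action H P \<mu> Q \<rho> g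
    = (\<mu> \<boxtimes> \<one> Q) \<cdot> ((inv (\<alpha> P H Q) \<cdot> (\<mu> \<boxtimes> \<one> (H \<otimes> Q))) \<cdot>
      ((\<one> (P \<otimes> H) \<boxtimes> ?F) \<cdot> (inv (\<alpha> P H Q) \<cdot> (\<one> P \<boxtimes> ?G))))"
    by (simp add: conv_action_def merge)
  \<comment> \<open>The first action commutes with the second coaction, since they concern different
    factors; after this both actions stand on the left and both coactions on the right.\<close>
  also have "inv (\<alpha> P H Q) \<cdot> (\<mu> \<boxtimes> \<one> (H \<otimes> Q)) = ((\<mu> \<boxtimes> \<one> H) \<boxtimes> \<one> Q) \<cdot> inv (\<alpha> (P \<otimes> H) H Q)"
    using associator_inv_nat [of \<mu> "\<one> H" "\<one> Q"] by simp
  also have "(\<mu> \<boxtimes> \<one> Q) \<cdot> ((((\<mu> \<boxtimes> \<one> H) \<boxtimes> \<one> Q) \<cdot> inv (\<alpha> (P \<otimes> H) H Q)) \<cdot>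
      ((\<one> (P \<otimes> H) \<boxtimes> ?F) \<cdot> (inv (\<alpha> P H Q) \<cdot> (\<one> P \<boxtimes> ?G))))
    = ((\<mu> \<cdot> (\<mu> \<boxtimes> \<one> H)) \<boxtimes> \<one> Q) \<cdot> (inv (\<alpha> (P \<otimes> H) H Q) \<cdot>
      (((\<one> (P \<otimes> H) \<boxtimes> ?F) \<cdot> inv (\<alpha> P H Q)) \<cdot> (\<one> P \<boxtimes> ?G)))"
    by (simp add: merge)
  also have "(\<one> (P \<otimes> H) \<boxtimes> ?F) \<cdot> inv (\<alpha> P H Q) = inv (\<alpha> P H (H \<otimes> Q)) \<cdot> (\<one> P \<boxtimes> (\<one> H \<boxtimes> ?F))"
    using associator_inv_nat [of "\<one> P" "\<one> H" ?F] by simp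
  also have "((\<mu> \<cdot> (\<mu> \<boxtimes> \<one> H)) \<boxtimes> \<one> Q) \<cdot> (inv (\<alpha> (P \<otimes> H) H Q) \<cdot>
      ((inv (\<alpha> P H (H \<otimes> Q)) \<cdot> (\<one> P \<boxtimes> (\<one> H \<boxtimes> ?F))) \<cdot> (\<one> P \<boxtimes> ?G)))
    = ((\<mu> \<cdot> (\<one> P \<boxtimes> m)) \<boxtimes> \<one> Q) \<cdot> (((\<alpha> P H H \<boxtimes> \<one> Q) \<cdot>
      (inv (\<alpha> (P \<otimes> H) H Q) \<cdot> inv (\<alpha> P H (H \<otimes> Q)))) \<cdot> (\<one> P \<boxtimes> ((\<one> H \<boxtimes> ?F) \<cdot> ?G)))"
    by (simp add: merge act)
  \<comment> \<open>The pentagon reconciles the associator produced by associativity of the action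
    with the one that coassociativity is going to cancel.\<close>
  also have "(\<alpha> P H H \<boxtimes> \<one> Q) \<cdot> (inv (\<alpha> (P \<otimes> H) H Q) \<cdot> inv (\<alpha> P H (H \<otimes> Q)))
    = inv (\<alpha> P (H \<otimes> H) Q) \<cdot> (\<one> P \<boxtimes> inv (\<alpha> H H Q))"
    by (rule pentagon_inverse_mixed) auto
  also have "((\<mu> \<cdot> (\<one> P \<boxtimes> m)) \<boxtimes> \<one> Q) \<cdot> ((inv (\<alpha> P (H \<otimes> H) Q) \<cdot> (\<one> P \<boxtimes> inv (\<alpha> H H Q))) \<cdot>
      (\<one> P \<boxtimes> ((\<one> H \<boxtimes> ?F) \<cdot> ?G)))
    = (\<mu> \<boxtimes> \<one> Q) \<cdot> ((((\<one> P \<boxtimes> m) \<boxtimes> \<one> Q) \<cdot> inv (\<alpha> P (H \<otimes> H) Q)) \<cdot>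
      (\<one> P \<boxtimes> ((((g \<boxtimes> f) \<cdot> \<Delta>) \<boxtimes> \<one> Q) \<cdot> \<rho>)))"
    by (subst FG) (simp add: merge)
  also have "((\<one> P \<boxtimes> m) \<boxtimes> \<one> Q) \<cdot> inv (\<alpha> P (H \<otimes> H) Q) = inv (\<alpha> P H Q) \<cdot> (\<one> P \<boxtimes> (m \<boxtimes> \<one> Q))"
    using associator_inv_nat [of "\<one> P" m "\<one> Q"] by simp
  finally show ?thesis
    by (simp add: conv_action_def conv_def merge)
qed

text \<open>The unit law of the action and the counit law of the coaction leave only
  \<open>\<r> P\<close> and \<open>inv (\<l> Q)\<close>, which cancel by the triangle.\<close>

lemma conv_action_unit:
  assumes mod: "right_module C (H, m, u) (P, \<mu>)" and comod: "left_comodule C (H, \<Delta>, \<epsilon>) (Q, \<rho>)"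
    and H [simp]: "H \<in> Obj C" and u: "u \<in> hom C \<I> H" and \<epsilon>: "\<epsilon> \<in> hom C H \<I>"
  shows "conv_action H P \<mu> Q \<rho> (u \<cdot> \<epsilon>) = \<one> (P \<otimes> Q)"
proof -
  have [simp]: "P \<in> Obj C" "Q \<in> Obj C" "\<mu> \<in> Arr C" "Dom C \<mu> = P \<otimes> H" "Cod C \<mu> = P"
    "\<rho> \<in> Arr C" "Dom C \<rho> = Q" "Cod C \<rho> = H \<otimes> Q" "u \<in> Arr C" "Dom C u = \<I>" "Cod C u = H"
    "\<epsilon> \<in> Arr C" "Dom C \<epsilon> = H" "Cod C \<epsilon> = \<I>"
    using mod comod u \<epsilon> by (auto simp: hom_iff)
  have act: "\<mu> \<cdot> (\<one> P \<boxtimes> u) = \<r> P" and coact: "(\<epsilon> \<boxtimes> \<one> Q) \<cdot> \<rho> = inv (\<l> Q)"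
    using mod comod by auto
  have "conv_action H P \<mu> Q \<rho> (u \<cdot> \<epsilon>)
    = (\<mu> \<boxtimes> \<one> Q) \<cdot> ((inv (\<alpha> P H Q) \<cdot> (\<one> P \<boxtimes> (u \<boxtimes> \<one> Q))) \<cdot> (\<one> P \<boxtimes> ((\<epsilon> \<boxtimes> \<one> Q) \<cdot> \<rho>)))"
    by (simp add: conv_action_def merge)
  also have "inv (\<alpha> P H Q) \<cdot> (\<one> P \<boxtimes> (u \<boxtimes> \<one> Q)) = ((\<one> P \<boxtimes> u) \<boxtimes> \<one> Q) \<cdot> inv (\<alpha> P \<I> Q)"
    using associator_inv_nat [of "\<one> P" u "\<one> Q"] by simp
  also have "(\<mu> \<boxtimes> \<one> Q) \<cdot> ((((\<one> P \<boxtimes> u) \<boxtimes> \<one> Q) \<cdot> inv (\<alpha> P \<I> Q)) \<cdot> (\<one> P \<boxtimes> ((\<epsilon> \<boxtimes> \<one> Q) \<cdot> \<rho>)))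
    = ((\<r> P \<boxtimes> \<one> Q) \<cdot> inv (\<alpha> P \<I> Q)) \<cdot> (\<one> P \<boxtimes> inv (\<l> Q))"
    by (simp add: merge act coact)
  also have "\<dots> = \<one> (P \<otimes> Q)"
    by (subst triangle_mixed) (simp_all add: merge)
  finally show ?thesis .
qed

text \<open>The inverse is the action of S; each antipode equation yields one of the two inverse
  laws.\<close>

lemma conv_action_inverse:
  assumes mod: "right_module C (H, m, u) (P, \<mu>)" and comod: "left_comodule C (H, \<Delta>, \<epsilon>) (Q, \<rho>)"
    and mon: "monoid C (H, m, u)" and comon: "comonoid C (H, \<Delta>, \<epsilon>)"
    and S: "S \<in> hom C H H" "conv m \<Delta> (\<one> H) S = u \<cdot> \<epsilon>" "conv m \<Delta> S (\<one> H) = u \<cdot> \<epsilon>"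
  shows "iso C (conv_action H P \<mu> Q \<rho> (\<one> H))"
proof (rule isoI)
  have *: "H \<in> Obj C" "m \<in> hom C (H \<otimes> H) H" "u \<in> hom C \<I> H" "\<Delta> \<in> hom C H (H \<otimes> H)" "\<epsilon> \<in> hom C H \<I>"
    "P \<in> Obj C" "Q \<in> Obj C" "\<mu> \<in> hom C (P \<otimes> H) P" "\<rho> \<in> hom C Q (H \<otimes> Q)" "\<one> H \<in> hom C H H"
    using mon comon mod comod ident_hom by auto
  show "inverse_arrows C (conv_action H P \<mu> Q \<rho> (\<one> H)) (conv_action H P \<mu> Q \<rho> S)"
    using * S by (simp add: inverse_arrows_iff conv_action_mult [OF mod comod]
      conv_action_unit [OF mod comod])
qed

section \<open>Reduction of the Galois maps to the action of the identity\<close>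

text \<open>The object X is carried to the far right: braiding it past H after the coaction and then
  past Q is the same as braiding it past Q before the coaction. Hence X is a mere spectator up to
  conjugation.\<close>

lemma iso_galois_map_iff:
  assumes H [simp]: "H \<in> Obj C" and P [simp]: "P \<in> Obj C" and X [simp]: "X \<in> Obj C"
    and Q [simp]: "Q \<in> Obj C" and \<mu>: "\<mu> \<in> hom C (P \<otimes> H) P" and \<rho>: "\<rho> \<in> hom C Q (H \<otimes> Q)"
  shows "iso C (galois_map C H (P, \<mu>) X (Q, \<rho>)) \<longleftrightarrow> iso C (conv_action H P \<mu> Q \<rho> (\<one> H) \<boxtimes> \<one> X)"
proof -
  have [simp]: "\<mu> \<in> Arr C" "Dom C \<mu> = P \<otimes> H" "Cod C \<mu> = P" "\<rho> \<in> Arr C" "Dom C \<rho> = Q" "Cod C \<rho> = H \<otimes> Q"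
    using \<mu> \<rho> by (auto simp: hom_iff)
  let ?mid = "\<alpha> H X Q \<cdot> ((\<sigma> X H \<boxtimes> \<one> Q) \<cdot> inv (\<alpha> X H Q))"
  let ?g = "galois_map C H (P, \<mu>) X (Q, \<rho>)" and ?k = "conv_action H P \<mu> Q \<rho> (\<one> H)"
  \<comment> \<open>The isomorphism that moves X behind Q. The goal is that it conjugates the Galois
    map into \<open>?k \<boxtimes> \<one> X\<close>, up to an associator.\<close>
  let ?t = "(\<one> P \<boxtimes> \<sigma> X Q) \<cdot> \<alpha> P X Q"
  have [simp]: "?g \<in> Arr C" "Dom C ?g = (P \<otimes> X) \<otimes> Q" "Cod C ?g = (P \<otimes> X) \<otimes> Q"
    by simp_all
  have k [simp]: "?k \<in> Arr C" "Dom C ?k = P \<otimes> Q" "Cod C ?k = P \<otimes> Q"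
    using \<mu> \<rho> ident_hom by simp_all
  \<comment> \<open>The first hexagon merges the two crossings of X, with H and with Q, into one
    crossing with H \<otimes> Q; naturality of the braiding then pulls the coaction out of
    it.\<close>
  have "(\<one> H \<boxtimes> \<sigma> X Q) \<cdot> ?mid = ((\<one> H \<boxtimes> \<sigma> X Q) \<cdot> \<alpha> H X Q \<cdot> (\<sigma> X H \<boxtimes> \<one> Q)) \<cdot> inv (\<alpha> X H Q)"
    by simp
  also have "\<dots> = \<alpha> H Q X \<cdot> \<sigma> X (H \<otimes> Q)"
    by (subst hexagon1 [symmetric]) simp_all
  finally have "((\<one> H \<boxtimes> \<sigma> X Q) \<cdot> ?mid) \<cdot> (\<one> X \<boxtimes> \<rho>) = (\<alpha> H Q X \<cdot> \<sigma> X (H \<otimes> Q)) \<cdot> (\<one> X \<boxtimes> \<rho>)"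
    by (rule arg_cong)
  then have "(\<one> H \<boxtimes> \<sigma> X Q) \<cdot> (?mid \<cdot> (\<one> X \<boxtimes> \<rho>)) = \<alpha> H Q X \<cdot> (\<sigma> X (H \<otimes> Q) \<cdot> (\<one> X \<boxtimes> \<rho>))"
    by simp
  also have "\<sigma> X (H \<otimes> Q) \<cdot> (\<one> X \<boxtimes> \<rho>) = (\<rho> \<boxtimes> \<one> X) \<cdot> \<sigma> X Q"
    using braiding_nat [of "\<one> X" \<rho>] by simp
  finally have mid: "(\<one> H \<boxtimes> \<sigma> X Q) \<cdot> (?mid \<cdot> (\<one> X \<boxtimes> \<rho>)) = \<alpha> H Q X \<cdot> ((\<rho> \<boxtimes> \<one> X) \<cdot> \<sigma> X Q)" .
  have "?t \<cdot> ?g = (\<mu> \<boxtimes> \<one> (Q \<otimes> X)) \<cdot> (((\<one> (P \<otimes> H) \<boxtimes> \<sigma> X Q) \<cdot> inv (\<alpha> P H (X \<otimes> Q))) \<cdot>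
      ((\<one> P \<boxtimes> ?mid) \<cdot> (\<alpha> P X (H \<otimes> Q) \<cdot> (\<one> (P \<otimes> X) \<boxtimes> \<rho>))))"
    by (simp add: interchange_eq merge)
  also have "(\<one> (P \<otimes> H) \<boxtimes> \<sigma> X Q) \<cdot> inv (\<alpha> P H (X \<otimes> Q)) = inv (\<alpha> P H (Q \<otimes> X)) \<cdot> (\<one> P \<boxtimes> (\<one> H \<boxtimes> \<sigma> X Q))"
    using associator_inv_nat [of "\<one> P" "\<one> H" "\<sigma> X Q"] by simp
  also have "\<alpha> P X (H \<otimes> Q) \<cdot> (\<one> (P \<otimes> X) \<boxtimes> \<rho>) = (\<one> P \<boxtimes> (\<one> X \<boxtimes> \<rho>)) \<cdot> \<alpha> P X Q"
    using associator_nat [of "\<one> P" "\<one> X" \<rho>] by simp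
  also have "(\<mu> \<boxtimes> \<one> (Q \<otimes> X)) \<cdot> ((inv (\<alpha> P H (Q \<otimes> X)) \<cdot> (\<one> P \<boxtimes> (\<one> H \<boxtimes> \<sigma> X Q))) \<cdot>
      ((\<one> P \<boxtimes> ?mid) \<cdot> ((\<one> P \<boxtimes> (\<one> X \<boxtimes> \<rho>)) \<cdot> \<alpha> P X Q)))
    = (\<mu> \<boxtimes> \<one> (Q \<otimes> X)) \<cdot> (inv (\<alpha> P H (Q \<otimes> X)) \<cdot>
      ((\<one> P \<boxtimes> ((\<one> H \<boxtimes> \<sigma> X Q) \<cdot> (?mid \<cdot> (\<one> X \<boxtimes> \<rho>)))) \<cdot> \<alpha> P X Q))"
    by (simp add: merge)
  also have "\<dots> = (\<mu> \<boxtimes> \<one> (Q \<otimes> X)) \<cdot> ((inv (\<alpha> P H (Q \<otimes> X)) \<cdot> (\<one> P \<boxtimes> \<alpha> H Q X)) \<cdot>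
      ((\<one> P \<boxtimes> (\<rho> \<boxtimes> \<one> X)) \<cdot> ?t))"
    by (subst mid) (simp add: merge)
  \<comment> \<open>The pentagon splits off X as the last tensor factor.\<close>
  also have "inv (\<alpha> P H (Q \<otimes> X)) \<cdot> (\<one> P \<boxtimes> \<alpha> H Q X)
      = \<alpha> (P \<otimes> H) Q X \<cdot> ((inv (\<alpha> P H Q) \<boxtimes> \<one> X) \<cdot> inv (\<alpha> P (H \<otimes> Q) X))"
    by (rule pentagon_mixed) auto
  also have "(\<mu> \<boxtimes> \<one> (Q \<otimes> X)) \<cdot> ((\<alpha> (P \<otimes> H) Q X \<cdot> ((inv (\<alpha> P H Q) \<boxtimes> \<one> X) \<cdot> inv (\<alpha> P (H \<otimes> Q) X))) \<cdot>
      ((\<one> P \<boxtimes> (\<rho> \<boxtimes> \<one> X)) \<cdot> ?t))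
    = ((\<mu> \<boxtimes> \<one> (Q \<otimes> X)) \<cdot> \<alpha> (P \<otimes> H) Q X) \<cdot> ((inv (\<alpha> P H Q) \<boxtimes> \<one> X) \<cdot>
      ((inv (\<alpha> P (H \<otimes> Q) X) \<cdot> (\<one> P \<boxtimes> (\<rho> \<boxtimes> \<one> X))) \<cdot> ?t))"
    by simp
  also have "(\<mu> \<boxtimes> \<one> (Q \<otimes> X)) \<cdot> \<alpha> (P \<otimes> H) Q X = \<alpha> P Q X \<cdot> ((\<mu> \<boxtimes> \<one> Q) \<boxtimes> \<one> X)"
    using associator_nat [of \<mu> "\<one> Q" "\<one> X"] by simp
  also have "inv (\<alpha> P (H \<otimes> Q) X) \<cdot> (\<one> P \<boxtimes> (\<rho> \<boxtimes> \<one> X)) = ((\<one> P \<boxtimes> \<rho>) \<boxtimes> \<one> X) \<cdot> inv (\<alpha> P Q X)"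
    using associator_inv_nat [of "\<one> P" \<rho> "\<one> X"] by simp
  also have "(\<alpha> P Q X \<cdot> ((\<mu> \<boxtimes> \<one> Q) \<boxtimes> \<one> X)) \<cdot> ((inv (\<alpha> P H Q) \<boxtimes> \<one> X) \<cdot>
      ((((\<one> P \<boxtimes> \<rho>) \<boxtimes> \<one> X) \<cdot> inv (\<alpha> P Q X)) \<cdot> ?t))
    = \<alpha> P Q X \<cdot> ((?k \<boxtimes> \<one> X) \<cdot> (inv (\<alpha> P Q X) \<cdot> ?t))"
    by (simp add: conv_action_def merge)
  finally have *: "?t \<cdot> ?g = \<alpha> P Q X \<cdot> ((?k \<boxtimes> \<one> X) \<cdot> (inv (\<alpha> P Q X) \<cdot> ?t))" .
  have "iso C ?g \<longleftrightarrow> iso C (?t \<cdot> ?g)"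
    by (rule iso_comp_left_iff [symmetric]) (simp_all del: galois_map.simps)
  also have "\<dots> \<longleftrightarrow> iso C (?k \<boxtimes> \<one> X)"
    unfolding * by (simp add: iso_comp_left_iff iso_comp_right_iff)
  finally show ?thesis .
qed

end

text \<open>The existence clause of \<open>hopf_monoid_braided\<close> in right-nested form. The
  category is an explicit argument, so that the clause can also be read in the opposite category
  with the two structures exchanged.\<close>

definition has_antipode :: "('o, 'a) braidcat \<Rightarrow> 'o \<Rightarrow> 'a \<Rightarrow> 'a \<Rightarrow> 'a \<Rightarrow> 'a \<Rightarrow> bool"
  where "has_antipode C H m u \<Delta> \<epsilon> \<longleftrightarrow>
    (\<exists>S \<in> hom C H H. m \<cdot>\<^bsub>C\<^esub> ((\<one>\<^bsub>C\<^esub> H \<boxtimes>\<^bsub>C\<^esub> S) \<cdot>\<^bsub>C\<^esub> \<Delta>) = u \<cdot>\<^bsub>C\<^esub> \<epsilon> \<and> m \<cdot>\<^bsub>C\<^esub> ((S \<boxtimes>\<^bsub>C\<^esub> \<one>\<^bsub>C\<^esub> H) \<cdot>\<^bsub>C\<^esub> \<Delta>) = u \<cdot>\<^bsub>C\<^esub> \<epsilon>)"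

context braided_monoidal_category
begin

section \<open>Antipodes in the duoidal sense\<close>

text \<open>The braiding in the definition only crosses Y with the unit object, so it merely
  exchanges unit constraints; what remains is padding by \<I> \<otimes> \<I> on the right.\<close>

lemma phi_eq:
  assumes [simp]: "X \<in> Obj C" "Y \<in> Obj C"
  shows "\<phi> C X Y = (\<one> (X \<otimes> Y) \<boxtimes> inv (\<l> \<I>)) \<cdot> inv (\<r> (X \<otimes> Y))"
proof -
  have braid: "\<sigma> \<I> Y \<cdot> inv (\<l> Y) = inv (\<r> Y)"
    by (rule cancel_left [where g = "\<r> Y"]) (simp_all add: reassoc [OF runit_braiding])
  have "\<alpha> Y \<I> \<I> \<cdot> ((\<sigma> \<I> Y \<boxtimes> \<one> \<I>) \<cdot> inv (\<alpha> \<I> Y \<I>)) \<cdot> ((\<one> \<I> \<boxtimes> inv (\<r> Y)) \<cdot> inv (\<l> Y))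
    = \<alpha> Y \<I> \<I> \<cdot> ((\<sigma> \<I> Y \<boxtimes> \<one> \<I>) \<cdot> ((inv (\<alpha> \<I> Y \<I>) \<cdot> inv (\<l> (Y \<otimes> \<I>))) \<cdot> inv (\<r> Y)))"
    using lunit_inv_nat [of "inv (\<r> Y)"] by simp
  also have "\<dots> = (\<alpha> Y \<I> \<I> \<cdot> (inv (\<r> Y) \<boxtimes> \<one> \<I>)) \<cdot> inv (\<r> Y)"
    by (subst lunit_inv_tensor) (simp_all add: merge braid)
  also have "\<dots> = (\<one> Y \<boxtimes> inv (\<l> \<I>)) \<cdot> inv (\<r> Y)"
    by (subst triangle_inverse_mixed) simp_all
  finally have mid: "\<alpha> Y \<I> \<I> \<cdot> ((\<sigma> \<I> Y \<boxtimes> \<one> \<I>) \<cdot> inv (\<alpha> \<I> Y \<I>)) \<cdot> ((\<one> \<I> \<boxtimes> inv (\<r> Y)) \<cdot> inv (\<l> Y))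
    = (\<one> Y \<boxtimes> inv (\<l> \<I>)) \<cdot> inv (\<r> Y)" .
  have "\<phi> C X Y = inv (\<alpha> X Y (\<I> \<otimes> \<I>)) \<cdot>
      (\<one> X \<boxtimes> (\<alpha> Y \<I> \<I> \<cdot> ((\<sigma> \<I> Y \<boxtimes> \<one> \<I>) \<cdot> inv (\<alpha> \<I> Y \<I>)) \<cdot> ((\<one> \<I> \<boxtimes> inv (\<r> Y)) \<cdot> inv (\<l> Y))))"
    by (simp add: \<phi>_def interchange_eq merge)
  also have "\<dots> = (inv (\<alpha> X Y (\<I> \<otimes> \<I>)) \<cdot> (\<one> X \<boxtimes> (\<one> Y \<boxtimes> inv (\<l> \<I>)))) \<cdot> (\<one> X \<boxtimes> inv (\<r> Y))"
    unfolding mid by (simp add: merge)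
  also have "inv (\<alpha> X Y (\<I> \<otimes> \<I>)) \<cdot> (\<one> X \<boxtimes> (\<one> Y \<boxtimes> inv (\<l> \<I>))) = (\<one> (X \<otimes> Y) \<boxtimes> inv (\<l> \<I>)) \<cdot> inv (\<alpha> X Y \<I>)"
    using associator_inv_nat [of "\<one> X" "\<one> Y" "inv (\<l> \<I>)"] by simp
  also have "\<dots> \<cdot> (\<one> X \<boxtimes> inv (\<r> Y)) = (\<one> (X \<otimes> Y) \<boxtimes> inv (\<l> \<I>)) \<cdot> inv (\<r> (X \<otimes> Y))"
    by (simp add: runit_inv_tensor)
  finally show ?thesis .
qed

text \<open>Likewise only padding by \<I> \<otimes> \<I>, now on the left, since X is braided past
  the unit object.\<close>

lemma psi_eq:
  assumes [simp]: "X \<in> Obj C" "Y \<in> Obj C"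
  shows "\<psi> C X Y = (inv (\<r> \<I>) \<boxtimes> \<one> (X \<otimes> Y)) \<cdot> inv (\<l> (X \<otimes> Y))"
proof -
  have braid: "\<sigma> X \<I> = inv (\<l> X) \<cdot> \<r> X"
    by (simp add: lunit_braiding [symmetric])
  have l: "\<alpha> \<I> X Y \<cdot> (inv (\<l> X) \<boxtimes> \<one> Y) = inv (\<l> (X \<otimes> Y))"
    by (simp add: lunit_inv_tensor [symmetric])
  have "\<alpha> \<I> X Y \<cdot> ((\<sigma> X \<I> \<boxtimes> \<one> Y) \<cdot> inv (\<alpha> X \<I> Y))
    = (\<alpha> \<I> X Y \<cdot> (inv (\<l> X) \<boxtimes> \<one> Y)) \<cdot> ((\<r> X \<boxtimes> \<one> Y) \<cdot> inv (\<alpha> X \<I> Y))"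
    by (simp add: braid merge)
  also have "\<dots> = inv (\<l> (X \<otimes> Y)) \<cdot> (\<one> X \<boxtimes> \<l> Y)"
    unfolding l by (simp add: triangle_mixed)
  finally have mid: "\<alpha> \<I> X Y \<cdot> ((\<sigma> X \<I> \<boxtimes> \<one> Y) \<cdot> inv (\<alpha> X \<I> Y)) = inv (\<l> (X \<otimes> Y)) \<cdot> (\<one> X \<boxtimes> \<l> Y)" .
  have "\<psi> C X Y = inv (\<alpha> \<I> \<I> (X \<otimes> Y)) \<cdot> ((\<one> \<I> \<boxtimes> (\<alpha> \<I> X Y \<cdot> ((\<sigma> X \<I> \<boxtimes> \<one> Y) \<cdot> inv (\<alpha> X \<I> Y)))) \<cdot>
      (\<alpha> \<I> X (\<I> \<otimes> Y) \<cdot> (\<alpha> (\<I> \<otimes> X) \<I> Y \<cdot> (((inv (\<l> X) \<boxtimes> \<one> \<I>) \<cdot> inv (\<r> X)) \<boxtimes> \<one> Y))))"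
    by (simp add: \<psi>_def interchange_eq merge)
  also have "\<dots> = inv (\<alpha> \<I> \<I> (X \<otimes> Y)) \<cdot> ((\<one> \<I> \<boxtimes> inv (\<l> (X \<otimes> Y))) \<cdot>
      (((\<one> \<I> \<boxtimes> (\<one> X \<boxtimes> \<l> Y)) \<cdot> \<alpha> \<I> X (\<I> \<otimes> Y)) \<cdot>
      (\<alpha> (\<I> \<otimes> X) \<I> Y \<cdot> (((inv (\<l> X) \<boxtimes> \<one> \<I>) \<cdot> inv (\<r> X)) \<boxtimes> \<one> Y))))"
    unfolding mid by (simp add: merge)
  also have "(\<one> \<I> \<boxtimes> (\<one> X \<boxtimes> \<l> Y)) \<cdot> \<alpha> \<I> X (\<I> \<otimes> Y) = \<alpha> \<I> X Y \<cdot> (\<one> (\<I> \<otimes> X) \<boxtimes> \<l> Y)"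
    using associator_nat [of "\<one> \<I>" "\<one> X" "\<l> Y"] by simp
  also have "(inv (\<l> X) \<boxtimes> \<one> \<I>) \<cdot> inv (\<r> X) = inv (\<r> (\<I> \<otimes> X)) \<cdot> inv (\<l> X)"
    using runit_inv_nat [of "inv (\<l> X)"] by simp
  also have "(\<alpha> \<I> X Y \<cdot> (\<one> (\<I> \<otimes> X) \<boxtimes> \<l> Y)) \<cdot>
      (\<alpha> (\<I> \<otimes> X) \<I> Y \<cdot> ((inv (\<r> (\<I> \<otimes> X)) \<cdot> inv (\<l> X)) \<boxtimes> \<one> Y))
    = \<alpha> \<I> X Y \<cdot> (((\<one> (\<I> \<otimes> X) \<boxtimes> \<l> Y) \<cdot> \<alpha> (\<I> \<otimes> X) \<I> Y) \<cdot> ((inv (\<r> (\<I> \<otimes> X)) \<cdot> inv (\<l> X)) \<boxtimes> \<one> Y))"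
    by simp
  also have "\<dots> = \<alpha> \<I> X Y \<cdot> (inv (\<l> X) \<boxtimes> \<one> Y)"
    by (subst triangle) (simp_all add: merge)
  also have "inv (\<alpha> \<I> \<I> (X \<otimes> Y)) \<cdot> ((\<one> \<I> \<boxtimes> inv (\<l> (X \<otimes> Y))) \<cdot> (\<alpha> \<I> X Y \<cdot> (inv (\<l> X) \<boxtimes> \<one> Y)))
    = (inv (\<r> \<I>) \<boxtimes> \<one> (X \<otimes> Y)) \<cdot> inv (\<l> (X \<otimes> Y))"
    unfolding l by (simp add: triangle_inverse_mixed [symmetric])
  finally show ?thesis .
qed

text \<open>By naturality of the unit constraints the padding slides past \<open>m\<close> and
  \<open>u\<close>. Each duoidal equation is thus the ordinary antipode equation composed on the
  left with one fixed isomorphism, which can be cancelled.\<close>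

lemma duoidal_antipode_equations:
  assumes [simp]: "H \<in> Obj C" and m: "m \<in> hom C (H \<otimes> H) H" and u: "u \<in> hom C \<I> H"
    and \<Delta>: "\<Delta> \<in> hom C H (H \<otimes> H)" and \<epsilon>: "\<epsilon> \<in> hom C H \<I>" and S: "S \<in> hom C H H"
  shows "(m \<boxtimes> \<one> (\<I> \<otimes> \<I>)) \<cdot> \<phi> C H H \<cdot> (\<one> H \<boxtimes> S) \<cdot> \<Delta>
      = (u \<boxtimes> \<one> (\<I> \<otimes> \<I>)) \<cdot> \<alpha> \<I> \<I> \<I> \<cdot> (\<Delta>\<^sub>I C \<boxtimes> \<one> \<I>) \<cdot> inv (\<l> \<I>) \<cdot> \<epsilon>
      \<longleftrightarrow> m \<cdot> ((\<one> H \<boxtimes> S) \<cdot> \<Delta>) = u \<cdot> \<epsilon>" (is "?L = ?R \<longleftrightarrow> ?l = ?r")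
    "(\<one> (\<I> \<otimes> \<I>) \<boxtimes> m) \<cdot> \<psi> C H H \<cdot> (S \<boxtimes> \<one> H) \<cdot> \<Delta>
      = (\<one> (\<I> \<otimes> \<I>) \<boxtimes> u) \<cdot> inv (\<alpha> \<I> \<I> \<I>) \<cdot> (\<one> \<I> \<boxtimes> \<Delta>\<^sub>I C) \<cdot> inv (\<r> \<I>) \<cdot> \<epsilon>
      \<longleftrightarrow> m \<cdot> ((S \<boxtimes> \<one> H) \<cdot> \<Delta>) = u \<cdot> \<epsilon>" (is "?L' = ?R' \<longleftrightarrow> ?l' = ?r")
proof -
  have [simp]: "m \<in> Arr C" "Dom C m = H \<otimes> H" "Cod C m = H" "u \<in> Arr C" "Dom C u = \<I>" "Cod C u = H"
    "\<Delta> \<in> Arr C" "Dom C \<Delta> = H" "Cod C \<Delta> = H \<otimes> H" "\<epsilon> \<in> Arr C" "Dom C \<epsilon> = H" "Cod C \<epsilon> = \<I>"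
    "S \<in> Arr C" "Dom C S = H" "Cod C S = H"
    using m u \<Delta> \<epsilon> S by (auto simp: hom_iff)
  \<comment> \<open>The two paddings of H, from H to H \<otimes> (\<I> \<otimes> \<I>) and to (\<I>
    \<otimes> \<I>) \<otimes> H.\<close>
  let ?k = "(\<one> H \<boxtimes> inv (\<l> \<I>)) \<cdot> inv (\<r> H)" and ?k' = "(inv (\<r> \<I>) \<boxtimes> \<one> H) \<cdot> inv (\<l> H)"
  have "?L = (\<one> H \<boxtimes> inv (\<l> \<I>)) \<cdot> (((m \<boxtimes> \<one> \<I>) \<cdot> inv (\<r> (H \<otimes> H))) \<cdot> ((\<one> H \<boxtimes> S) \<cdot> \<Delta>))"
    by (simp add: phi_eq merge)
  also have "(m \<boxtimes> \<one> \<I>) \<cdot> inv (\<r> (H \<otimes> H)) = inv (\<r> H) \<cdot> m"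
    using runit_inv_nat [of m] by simp
  finally have L: "?L = ?k \<cdot> ?l"
    by simp
  \<comment> \<open>Identifying \<open>\<l> \<I>\<close> with \<open>\<r> \<I>\<close> brings
    \<open>\<Delta>\<^sub>I\<close> into the form to which the triangle applies.\<close>
  have "?R = (u \<boxtimes> \<one> (\<I> \<otimes> \<I>)) \<cdot> ((\<alpha> \<I> \<I> \<I> \<cdot> (inv (\<r> \<I>) \<boxtimes> \<one> \<I>)) \<cdot> (inv (\<r> \<I>) \<cdot> \<epsilon>))"
    by (simp add: \<Delta>\<^sub>I_def lunit_unit)
  also have "\<dots> = (\<one> H \<boxtimes> inv (\<l> \<I>)) \<cdot> (((u \<boxtimes> \<one> \<I>) \<cdot> inv (\<r> \<I>)) \<cdot> \<epsilon>)"
    by (subst triangle_inverse_mixed) (simp_all add: merge)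
  also have "(u \<boxtimes> \<one> \<I>) \<cdot> inv (\<r> \<I>) = inv (\<r> H) \<cdot> u"
    using runit_inv_nat [of u] by simp
  finally have R: "?R = ?k \<cdot> ?r"
    by simp
  show "?L = ?R \<longleftrightarrow> ?l = ?r"
    unfolding L R by (rule iffI, erule cancel_left) simp_all
  have "?L' = (inv (\<r> \<I>) \<boxtimes> \<one> H) \<cdot> (((\<one> \<I> \<boxtimes> m) \<cdot> inv (\<l> (H \<otimes> H))) \<cdot> ((S \<boxtimes> \<one> H) \<cdot> \<Delta>))"
    by (simp add: psi_eq merge)
  also have "(\<one> \<I> \<boxtimes> m) \<cdot> inv (\<l> (H \<otimes> H)) = inv (\<l> H) \<cdot> m"
    using lunit_inv_nat [of m] by simp
  finally have L': "?L' = ?k' \<cdot> ?l'"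
    by simp
  have unit: "inv (\<alpha> \<I> \<I> \<I>) \<cdot> (\<one> \<I> \<boxtimes> inv (\<l> \<I>)) = inv (\<r> \<I>) \<boxtimes> \<one> \<I>"
    by (simp add: triangle_inverse_mixed [symmetric])
  have "?R' = (\<one> (\<I> \<otimes> \<I>) \<boxtimes> u) \<cdot> ((inv (\<alpha> \<I> \<I> \<I>) \<cdot> (\<one> \<I> \<boxtimes> inv (\<l> \<I>))) \<cdot> (inv (\<l> \<I>) \<cdot> \<epsilon>))"
    by (simp add: \<Delta>\<^sub>I_def flip: lunit_unit)
  also have "\<dots> = (inv (\<r> \<I>) \<boxtimes> \<one> H) \<cdot> (((\<one> \<I> \<boxtimes> u) \<cdot> inv (\<l> \<I>)) \<cdot> \<epsilon>)"
    unfolding unit by (simp add: merge)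
  also have "(\<one> \<I> \<boxtimes> u) \<cdot> inv (\<l> \<I>) = inv (\<l> H) \<cdot> u"
    using lunit_inv_nat [of u] by simp
  finally have R': "?R' = ?k' \<cdot> ?r"
    by simp
  show "?L' = ?R' \<longleftrightarrow> ?l' = ?r"
    unfolding L' R' by (rule iffI, erule cancel_left) simp_all
qed

lemma hopf_monoid_braided_iff:
  assumes "bimonoid C (H, m, u, \<Delta>, \<epsilon>)"
  shows "hopf_monoid_braided C (H, m, u, \<Delta>, \<epsilon>) \<longleftrightarrow> has_antipode C H m u \<Delta> \<epsilon>"
proof -
  have "m \<cdot> (\<one> H \<boxtimes> S) \<cdot> \<Delta> = m \<cdot> ((\<one> H \<boxtimes> S) \<cdot> \<Delta>)" "m \<cdot> (S \<boxtimes> \<one> H) \<cdot> \<Delta> = m \<cdot> ((S \<boxtimes> \<one> H) \<cdot> \<Delta>)"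
    if "S \<in> hom C H H" for S
    using that assms by (auto simp: hom_iff)
  then show ?thesis
    using assms by (auto simp: has_antipode_def)
qed

lemma hopf_monoid_duoidal_iff:
  assumes "bimonoid C (H, m, u, \<Delta>, \<epsilon>)"
  shows "hopf_monoid_duoidal C (H, m, u, \<Delta>, \<epsilon>) \<longleftrightarrow> has_antipode C H m u \<Delta> \<epsilon>"
proof -
  have "H \<in> Obj C" "m \<in> hom C (H \<otimes> H) H" "u \<in> hom C \<I> H" "\<Delta> \<in> hom C H (H \<otimes> H)" "\<epsilon> \<in> hom C H \<I>"
    using assms by auto
  from duoidal_antipode_equations [OF this] show ?thesis
    using assms by (simp add: has_antipode_def del: bimonoid.simps)
qed

section \<open>Antipodes from invertible fusion morphisms\<close>

text \<open>H \<otimes> H is the free left module on its second factor. The arrow multiplies its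
  first factor on the right, which commutes with left multiplication because \<open>m\<close> is
  associative.\<close>

lemma conv_action_left_linear:
  assumes mon: "monoid C (H, m, u)" and comon: "comonoid C (H, \<Delta>, \<epsilon>)"
  defines "F \<equiv> conv_action H H m H \<Delta> (\<one> H)"
  shows "F \<cdot> (m \<boxtimes> \<one> H) = (m \<boxtimes> \<one> H) \<cdot> (inv (\<alpha> H H H) \<cdot> ((\<one> H \<boxtimes> F) \<cdot> \<alpha> H H H))"
proof -
  have [simp]: "H \<in> Obj C" "m \<in> Arr C" "Dom C m = H \<otimes> H" "Cod C m = H"
    "\<Delta> \<in> Arr C" "Dom C \<Delta> = H" "Cod C \<Delta> = H \<otimes> H"
    using mon comon by (auto simp: hom_iff)
  have assoc_m: "m \<cdot> (m \<boxtimes> \<one> H) = m \<cdot> ((\<one> H \<boxtimes> m) \<cdot> \<alpha> H H H)"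
    using mon by simp
  have F: "F = (m \<boxtimes> \<one> H) \<cdot> (inv (\<alpha> H H H) \<cdot> (\<one> H \<boxtimes> \<Delta>))"
    by (simp add: F_def conv_action_def)
  have "(\<one> H \<boxtimes> F) \<cdot> \<alpha> H H H = (\<one> H \<boxtimes> (m \<boxtimes> \<one> H)) \<cdot> ((\<one> H \<boxtimes> inv (\<alpha> H H H)) \<cdot> ((\<one> H \<boxtimes> (\<one> H \<boxtimes> \<Delta>)) \<cdot> \<alpha> H H H))"
    by (simp add: F merge)
  also have "(\<one> H \<boxtimes> (\<one> H \<boxtimes> \<Delta>)) \<cdot> \<alpha> H H H = \<alpha> H H (H \<otimes> H) \<cdot> (\<one> (H \<otimes> H) \<boxtimes> \<Delta>)"
    using associator_nat [of "\<one> H" "\<one> H" \<Delta>] by simp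
  finally have "(m \<boxtimes> \<one> H) \<cdot> (inv (\<alpha> H H H) \<cdot> ((\<one> H \<boxtimes> F) \<cdot> \<alpha> H H H))
    = (m \<boxtimes> \<one> H) \<cdot> ((inv (\<alpha> H H H) \<cdot> (\<one> H \<boxtimes> (m \<boxtimes> \<one> H))) \<cdot>
      ((\<one> H \<boxtimes> inv (\<alpha> H H H)) \<cdot> (\<alpha> H H (H \<otimes> H) \<cdot> (\<one> (H \<otimes> H) \<boxtimes> \<Delta>))))"
    by simp
  also have "inv (\<alpha> H H H) \<cdot> (\<one> H \<boxtimes> (m \<boxtimes> \<one> H)) = ((\<one> H \<boxtimes> m) \<boxtimes> \<one> H) \<cdot> inv (\<alpha> H (H \<otimes> H) H)"
    using associator_inv_nat [of "\<one> H" m "\<one> H"] by simp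
  also have "(m \<boxtimes> \<one> H) \<cdot> ((((\<one> H \<boxtimes> m) \<boxtimes> \<one> H) \<cdot> inv (\<alpha> H (H \<otimes> H) H)) \<cdot>
      ((\<one> H \<boxtimes> inv (\<alpha> H H H)) \<cdot> (\<alpha> H H (H \<otimes> H) \<cdot> (\<one> (H \<otimes> H) \<boxtimes> \<Delta>))))
    = ((m \<cdot> (\<one> H \<boxtimes> m)) \<boxtimes> \<one> H) \<cdot> ((inv (\<alpha> H (H \<otimes> H) H) \<cdot> (\<one> H \<boxtimes> inv (\<alpha> H H H))) \<cdot>
      (\<alpha> H H (H \<otimes> H) \<cdot> (\<one> (H \<otimes> H) \<boxtimes> \<Delta>)))"
    by (simp add: merge)
  \<comment> \<open>The pentagon exposes the associator that associativity of \<open>m\<close>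
    needs.\<close>
  also have "inv (\<alpha> H (H \<otimes> H) H) \<cdot> (\<one> H \<boxtimes> inv (\<alpha> H H H))
    = (\<alpha> H H H \<boxtimes> \<one> H) \<cdot> (inv (\<alpha> (H \<otimes> H) H H) \<cdot> inv (\<alpha> H H (H \<otimes> H)))"
    by (rule pentagon_inverse_mixed [symmetric]) auto
  also have "((m \<cdot> (\<one> H \<boxtimes> m)) \<boxtimes> \<one> H) \<cdot> (((\<alpha> H H H \<boxtimes> \<one> H) \<cdot> (inv (\<alpha> (H \<otimes> H) H H) \<cdot>
      inv (\<alpha> H H (H \<otimes> H)))) \<cdot> (\<alpha> H H (H \<otimes> H) \<cdot> (\<one> (H \<otimes> H) \<boxtimes> \<Delta>)))
    = ((m \<cdot> (m \<boxtimes> \<one> H)) \<boxtimes> \<one> H) \<cdot> (inv (\<alpha> (H \<otimes> H) H H) \<cdot> (\<one> (H \<otimes> H) \<boxtimes> \<Delta>))"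
    by (simp add: merge assoc_m)
  also have "\<dots> = (m \<boxtimes> \<one> H) \<cdot> ((((m \<boxtimes> \<one> H) \<boxtimes> \<one> H) \<cdot> inv (\<alpha> (H \<otimes> H) H H)) \<cdot> (\<one> (H \<otimes> H) \<boxtimes> \<Delta>))"
    by (simp add: merge)
  also have "((m \<boxtimes> \<one> H) \<boxtimes> \<one> H) \<cdot> inv (\<alpha> (H \<otimes> H) H H) = inv (\<alpha> H H H) \<cdot> (m \<boxtimes> \<one> (H \<otimes> H))"
    using associator_inv_nat [of m "\<one> H" "\<one> H"] by simp
  finally show ?thesis
    by (simp add: F merge)
qed

text \<open>The arrow takes the left leg of the second factor, which by coassociativity commutes
  with splitting off the right leg.\<close>

lemma conv_action_right_colinear:
  assumes mon: "monoid C (H, m, u)" and comon: "comonoid C (H, \<Delta>, \<epsilon>)"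
  defines "F \<equiv> conv_action H H m H \<Delta> (\<one> H)"
  shows "\<alpha> H H H \<cdot> ((F \<boxtimes> \<one> H) \<cdot> inv (\<alpha> H H H)) \<cdot> (\<one> H \<boxtimes> \<Delta>) = (\<one> H \<boxtimes> \<Delta>) \<cdot> F"
proof -
  have [simp]: "H \<in> Obj C" "m \<in> Arr C" "Dom C m = H \<otimes> H" "Cod C m = H"
    "\<Delta> \<in> Arr C" "Dom C \<Delta> = H" "Cod C \<Delta> = H \<otimes> H"
    using mon comon by (auto simp: hom_iff)
  have coassoc: "\<alpha> H H H \<cdot> ((\<Delta> \<boxtimes> \<one> H) \<cdot> \<Delta>) = (\<one> H \<boxtimes> \<Delta>) \<cdot> \<Delta>"
    using comon by simp
  have F: "F = (m \<boxtimes> \<one> H) \<cdot> (inv (\<alpha> H H H) \<cdot> (\<one> H \<boxtimes> \<Delta>))"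
    by (simp add: F_def conv_action_def)
  have "\<alpha> H H H \<cdot> ((F \<boxtimes> \<one> H) \<cdot> inv (\<alpha> H H H)) \<cdot> (\<one> H \<boxtimes> \<Delta>)
    = (\<alpha> H H H \<cdot> ((m \<boxtimes> \<one> H) \<boxtimes> \<one> H)) \<cdot> ((inv (\<alpha> H H H) \<boxtimes> \<one> H) \<cdot>
      ((((\<one> H \<boxtimes> \<Delta>) \<boxtimes> \<one> H) \<cdot> inv (\<alpha> H H H)) \<cdot> (\<one> H \<boxtimes> \<Delta>)))"
    by (simp add: F merge)
  also have "\<alpha> H H H \<cdot> ((m \<boxtimes> \<one> H) \<boxtimes> \<one> H) = (m \<boxtimes> \<one> (H \<otimes> H)) \<cdot> \<alpha> (H \<otimes> H) H H"
    using associator_nat [of m "\<one> H" "\<one> H"] by simp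
  also have "((\<one> H \<boxtimes> \<Delta>) \<boxtimes> \<one> H) \<cdot> inv (\<alpha> H H H) = inv (\<alpha> H (H \<otimes> H) H) \<cdot> (\<one> H \<boxtimes> (\<Delta> \<boxtimes> \<one> H))"
    using associator_inv_nat [of "\<one> H" \<Delta> "\<one> H"] by simp
  also have "((m \<boxtimes> \<one> (H \<otimes> H)) \<cdot> \<alpha> (H \<otimes> H) H H) \<cdot> ((inv (\<alpha> H H H) \<boxtimes> \<one> H) \<cdot>
      ((inv (\<alpha> H (H \<otimes> H) H) \<cdot> (\<one> H \<boxtimes> (\<Delta> \<boxtimes> \<one> H))) \<cdot> (\<one> H \<boxtimes> \<Delta>)))
    = (m \<boxtimes> \<one> (H \<otimes> H)) \<cdot> ((\<alpha> (H \<otimes> H) H H \<cdot> ((inv (\<alpha> H H H) \<boxtimes> \<one> H) \<cdot> inv (\<alpha> H (H \<otimes> H) H))) \<cdot>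
      (\<one> H \<boxtimes> ((\<Delta> \<boxtimes> \<one> H) \<cdot> \<Delta>)))"
    by (simp add: merge)
  \<comment> \<open>As in the linear case, the pentagon exposes the associator of the law to be
    used, here coassociativity.\<close>
  also have "\<alpha> (H \<otimes> H) H H \<cdot> ((inv (\<alpha> H H H) \<boxtimes> \<one> H) \<cdot> inv (\<alpha> H (H \<otimes> H) H))
    = inv (\<alpha> H H (H \<otimes> H)) \<cdot> (\<one> H \<boxtimes> \<alpha> H H H)"
    by (rule pentagon_mixed [symmetric]) auto
  also have "(m \<boxtimes> \<one> (H \<otimes> H)) \<cdot> ((inv (\<alpha> H H (H \<otimes> H)) \<cdot> (\<one> H \<boxtimes> \<alpha> H H H)) \<cdot> (\<one> H \<boxtimes> ((\<Delta> \<boxtimes> \<one> H) \<cdot> \<Delta>)))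
    = (m \<boxtimes> \<one> (H \<otimes> H)) \<cdot> (inv (\<alpha> H H (H \<otimes> H)) \<cdot> (\<one> H \<boxtimes> ((\<one> H \<boxtimes> \<Delta>) \<cdot> \<Delta>)))"
    by (simp add: merge coassoc)
  also have "\<dots> = (m \<boxtimes> \<one> (H \<otimes> H)) \<cdot> ((inv (\<alpha> H H (H \<otimes> H)) \<cdot> (\<one> H \<boxtimes> (\<one> H \<boxtimes> \<Delta>))) \<cdot> (\<one> H \<boxtimes> \<Delta>))"
    by (simp add: merge)
  also have "inv (\<alpha> H H (H \<otimes> H)) \<cdot> (\<one> H \<boxtimes> (\<one> H \<boxtimes> \<Delta>)) = (\<one> (H \<otimes> H) \<boxtimes> \<Delta>) \<cdot> inv (\<alpha> H H H)"
    using associator_inv_nat [of "\<one> H" "\<one> H" \<Delta>] by simp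
  finally show ?thesis
    by (simp add: F merge)
qed

section \<open>Recovering the antipode from the inverse\<close>

text \<open>A left linear map out of the free module H \<otimes> H is determined by its restriction
  along \<open>u\<close> in the first factor, and a right colinear map into the cofree comodule H
  \<otimes> H by its composite with \<open>\<epsilon>\<close> on the second. Doing both leaves an
  endomorphism of H, and the laws rebuild G from it.\<close>

lemma bilinear_is_conv_action:
  assumes mon: "monoid C (H, m, u)" and comon: "comonoid C (H, \<Delta>, \<epsilon>)"
    and G: "G \<in> hom C (H \<otimes> H) (H \<otimes> H)"
    and left: "G \<cdot> (m \<boxtimes> \<one> H) = (m \<boxtimes> \<one> H) \<cdot> (inv (\<alpha> H H H) \<cdot> ((\<one> H \<boxtimes> G) \<cdot> \<alpha> H H H))"
    and right: "\<alpha> H H H \<cdot> ((G \<boxtimes> \<one> H) \<cdot> inv (\<alpha> H H H)) \<cdot> (\<one> H \<boxtimes> \<Delta>) = (\<one> H \<boxtimes> \<Delta>) \<cdot> G"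
  shows "\<exists>S \<in> hom C H H. G = conv_action H H m H \<Delta> S"
proof -
  have [simp]: "H \<in> Obj C" "m \<in> Arr C" "Dom C m = H \<otimes> H" "Cod C m = H"
    "\<Delta> \<in> Arr C" "Dom C \<Delta> = H" "Cod C \<Delta> = H \<otimes> H" "u \<in> Arr C" "Dom C u = \<I>" "Cod C u = H"
    "\<epsilon> \<in> Arr C" "Dom C \<epsilon> = H" "Cod C \<epsilon> = \<I>" "G \<in> Arr C" "Dom C G = H \<otimes> H" "Cod C G = H \<otimes> H"
    using mon comon G by (auto simp: hom_iff)
  have unit: "m \<cdot> (\<one> H \<boxtimes> u) = \<r> H" and counit: "(\<epsilon> \<boxtimes> \<one> H) \<cdot> \<Delta> = inv (\<l> H)"
    using mon comon by auto
  \<comment> \<open>\<open>?G0\<close> is G restricted along the unit; \<open>?S\<close> is its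
    composite with the counit.\<close>
  let ?G0 = "G \<cdot> ((u \<boxtimes> \<one> H) \<cdot> inv (\<l> H))"
  let ?S = "\<r> H \<cdot> ((\<one> H \<boxtimes> \<epsilon>) \<cdot> ?G0)"
  have "((u \<boxtimes> \<one> H) \<boxtimes> \<one> H) \<cdot> ((inv (\<l> H) \<boxtimes> \<one> H) \<cdot> \<Delta>)
    = (((u \<boxtimes> \<one> H) \<boxtimes> \<one> H) \<cdot> inv (\<alpha> \<I> H H)) \<cdot> (inv (\<l> (H \<otimes> H)) \<cdot> \<Delta>)"
    by (subst lunit_inv_tensor [symmetric]) simp_all
  also have "((u \<boxtimes> \<one> H) \<boxtimes> \<one> H) \<cdot> inv (\<alpha> \<I> H H) = inv (\<alpha> H H H) \<cdot> (u \<boxtimes> \<one> (H \<otimes> H))"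
    using associator_inv_nat [of u "\<one> H" "\<one> H"] by simp
  also have "inv (\<l> (H \<otimes> H)) \<cdot> \<Delta> = (\<one> \<I> \<boxtimes> \<Delta>) \<cdot> inv (\<l> H)"
    using lunit_inv_nat [of \<Delta>] by simp
  also have "(inv (\<alpha> H H H) \<cdot> (u \<boxtimes> \<one> (H \<otimes> H))) \<cdot> ((\<one> \<I> \<boxtimes> \<Delta>) \<cdot> inv (\<l> H))
    = inv (\<alpha> H H H) \<cdot> ((\<one> H \<boxtimes> \<Delta>) \<cdot> ((u \<boxtimes> \<one> H) \<cdot> inv (\<l> H)))"
    by (simp add: merge)
  finally have *: "((u \<boxtimes> \<one> H) \<boxtimes> \<one> H) \<cdot> ((inv (\<l> H) \<boxtimes> \<one> H) \<cdot> \<Delta>)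
    = inv (\<alpha> H H H) \<cdot> ((\<one> H \<boxtimes> \<Delta>) \<cdot> ((u \<boxtimes> \<one> H) \<cdot> inv (\<l> H)))" .
  \<comment> \<open>First reconstruction: right colinearity of G and the counit law recover
    \<open>?G0\<close> from \<open>?S\<close>.\<close>
  have "(?S \<boxtimes> \<one> H) \<cdot> \<Delta> = (\<r> H \<boxtimes> \<one> H) \<cdot> (((\<one> H \<boxtimes> \<epsilon>) \<boxtimes> \<one> H) \<cdot> ((G \<boxtimes> \<one> H) \<cdot>
      (((u \<boxtimes> \<one> H) \<boxtimes> \<one> H) \<cdot> ((inv (\<l> H) \<boxtimes> \<one> H) \<cdot> \<Delta>))))"
    by (simp add: merge)
  also have "\<dots> = (\<r> H \<boxtimes> \<one> H) \<cdot> (((\<one> H \<boxtimes> \<epsilon>) \<boxtimes> \<one> H) \<cdot> (inv (\<alpha> H H H) \<cdot>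
      ((\<alpha> H H H \<cdot> ((G \<boxtimes> \<one> H) \<cdot> inv (\<alpha> H H H)) \<cdot> (\<one> H \<boxtimes> \<Delta>)) \<cdot> ((u \<boxtimes> \<one> H) \<cdot> inv (\<l> H)))))"
    unfolding * by simp
  also have "\<dots> = (\<r> H \<boxtimes> \<one> H) \<cdot> ((((\<one> H \<boxtimes> \<epsilon>) \<boxtimes> \<one> H) \<cdot> inv (\<alpha> H H H)) \<cdot> ((\<one> H \<boxtimes> \<Delta>) \<cdot> ?G0))"
    unfolding right by simp
  also have "((\<one> H \<boxtimes> \<epsilon>) \<boxtimes> \<one> H) \<cdot> inv (\<alpha> H H H) = inv (\<alpha> H \<I> H) \<cdot> (\<one> H \<boxtimes> (\<epsilon> \<boxtimes> \<one> H))"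
    using associator_inv_nat [of "\<one> H" \<epsilon> "\<one> H"] by simp
  also have "(\<r> H \<boxtimes> \<one> H) \<cdot> ((inv (\<alpha> H \<I> H) \<cdot> (\<one> H \<boxtimes> (\<epsilon> \<boxtimes> \<one> H))) \<cdot> ((\<one> H \<boxtimes> \<Delta>) \<cdot> ?G0))
    = ((\<r> H \<boxtimes> \<one> H) \<cdot> inv (\<alpha> H \<I> H)) \<cdot> ((\<one> H \<boxtimes> ((\<epsilon> \<boxtimes> \<one> H) \<cdot> \<Delta>)) \<cdot> ?G0)"
    by (simp add: merge)
  also have "\<dots> = ?G0"
    unfolding counit by (subst triangle_mixed) (simp_all add: merge)
  finally have G0: "(?S \<boxtimes> \<one> H) \<cdot> \<Delta> = ?G0" .
  have **: "\<alpha> H H H \<cdot> (((\<one> H \<boxtimes> u) \<boxtimes> \<one> H) \<cdot> inv (\<alpha> H \<I> H)) = \<one> H \<boxtimes> (u \<boxtimes> \<one> H)"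
    using associator_inv_nat [of "\<one> H" u "\<one> H", symmetric] by simp
  \<comment> \<open>Second reconstruction: left linearity of G and the unit law recover G from
    \<open>?G0\<close>.\<close>
  have "conv_action H H m H \<Delta> ?S
    = (m \<boxtimes> \<one> H) \<cdot> (inv (\<alpha> H H H) \<cdot> ((\<one> H \<boxtimes> G) \<cdot> ((\<one> H \<boxtimes> (u \<boxtimes> \<one> H)) \<cdot> (\<one> H \<boxtimes> inv (\<l> H)))))"
    unfolding conv_action_def G0 by (simp add: merge)
  also have "\<dots> = ((m \<boxtimes> \<one> H) \<cdot> (inv (\<alpha> H H H) \<cdot> ((\<one> H \<boxtimes> G) \<cdot> \<alpha> H H H))) \<cdot>
      (((\<one> H \<boxtimes> u) \<boxtimes> \<one> H) \<cdot> (inv (\<alpha> H \<I> H) \<cdot> (\<one> H \<boxtimes> inv (\<l> H))))"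
    by (subst ** [symmetric]) simp
  also have "\<dots> = G \<cdot> (((m \<cdot> (\<one> H \<boxtimes> u)) \<boxtimes> \<one> H) \<cdot> (inv (\<alpha> H \<I> H) \<cdot> (\<one> H \<boxtimes> inv (\<l> H))))"
    unfolding left [symmetric] by (simp add: merge)
  also have "\<dots> = G \<cdot> (((\<r> H \<boxtimes> \<one> H) \<cdot> inv (\<alpha> H \<I> H)) \<cdot> (\<one> H \<boxtimes> inv (\<l> H)))"
    unfolding unit by simp
  also have "\<dots> = G"
    by (subst triangle_mixed) (simp_all add: merge)
  finally have "G = conv_action H H m H \<Delta> ?S"
    by simp
  moreover have "?S \<in> hom C H H"
    by (simp add: hom_iff)
  ultimately show ?thesis
    by blast
qed

text \<open>Inserting \<open>u\<close> in the first factor and applying \<open>\<epsilon>\<close> to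
  the second extracts \<open>k\<close> from its action, by the unit and counit laws. This gives the
  action a left inverse.\<close>

lemma conv_action_inj:
  assumes mon: "monoid C (H, m, u)" and comon: "comonoid C (H, \<Delta>, \<epsilon>)"
    and f: "f \<in> hom C H H" and g: "g \<in> hom C H H"
    and eq: "conv_action H H m H \<Delta> f = conv_action H H m H \<Delta> g"
  shows "f = g"
proof -
  have [simp]: "H \<in> Obj C" "m \<in> Arr C" "Dom C m = H \<otimes> H" "Cod C m = H"
    "\<Delta> \<in> Arr C" "Dom C \<Delta> = H" "Cod C \<Delta> = H \<otimes> H" "u \<in> Arr C" "Dom C u = \<I>" "Cod C u = H"
    "\<epsilon> \<in> Arr C" "Dom C \<epsilon> = H" "Cod C \<epsilon> = \<I>"
    using mon comon by (auto simp: hom_iff)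
  have unit: "m \<cdot> (u \<boxtimes> \<one> H) = \<l> H" and counit: "(\<one> H \<boxtimes> \<epsilon>) \<cdot> \<Delta> = inv (\<r> H)"
    using mon comon by auto
  have "\<r> H \<cdot> ((\<one> H \<boxtimes> \<epsilon>) \<cdot> (conv_action H H m H \<Delta> k \<cdot> ((u \<boxtimes> \<one> H) \<cdot> inv (\<l> H)))) = k"
    if "k \<in> hom C H H" for k
  proof -
    have [simp]: "k \<in> Arr C" "Dom C k = H" "Cod C k = H"
      using that by (auto simp: hom_iff)
    let ?K = "(k \<boxtimes> \<one> H) \<cdot> \<Delta>"
    have "conv_action H H m H \<Delta> k \<cdot> ((u \<boxtimes> \<one> H) \<cdot> inv (\<l> H))
      = (m \<boxtimes> \<one> H) \<cdot> ((inv (\<alpha> H H H) \<cdot> (u \<boxtimes> \<one> (H \<otimes> H))) \<cdot> ((\<one> \<I> \<boxtimes> ?K) \<cdot> inv (\<l> H)))"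
      by (simp add: conv_action_def merge)
    also have "inv (\<alpha> H H H) \<cdot> (u \<boxtimes> \<one> (H \<otimes> H)) = ((u \<boxtimes> \<one> H) \<boxtimes> \<one> H) \<cdot> inv (\<alpha> \<I> H H)"
      using associator_inv_nat [of u "\<one> H" "\<one> H"] by simp
    also have "(\<one> \<I> \<boxtimes> ?K) \<cdot> inv (\<l> H) = inv (\<l> (H \<otimes> H)) \<cdot> ?K"
      using lunit_inv_nat [of ?K] by simp
    also have "(m \<boxtimes> \<one> H) \<cdot> ((((u \<boxtimes> \<one> H) \<boxtimes> \<one> H) \<cdot> inv (\<alpha> \<I> H H)) \<cdot> (inv (\<l> (H \<otimes> H)) \<cdot> ?K))
      = (\<l> H \<boxtimes> \<one> H) \<cdot> ((inv (\<alpha> \<I> H H) \<cdot> inv (\<l> (H \<otimes> H))) \<cdot> ?K)"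
      by (simp add: merge unit)
    also have "\<dots> = ?K"
      by (subst lunit_inv_tensor) (simp_all add: merge)
    finally have K: "conv_action H H m H \<Delta> k \<cdot> ((u \<boxtimes> \<one> H) \<cdot> inv (\<l> H)) = ?K" .
    have "(\<one> H \<boxtimes> \<epsilon>) \<cdot> ?K = (k \<boxtimes> \<one> \<I>) \<cdot> ((\<one> H \<boxtimes> \<epsilon>) \<cdot> \<Delta>)"
      by (simp add: merge)
    also have "\<dots> = inv (\<r> H) \<cdot> k"
      unfolding counit using runit_inv_nat [of k] by simp
    finally show ?thesis
      unfolding K by simp
  qed
  then show ?thesis
    using f g eq by metis
qed

text \<open>Towards the antipode, the inverse of \<kappa> is again bilinear, hence the action of
  some S. Multiplicativity and injectivity of the action then turn the two inverse laws into the two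
  antipode equations.\<close>

lemma has_antipode_iff_iso_conv_action:
  assumes mon: "monoid C (H, m, u)" and comon: "comonoid C (H, \<Delta>, \<epsilon>)"
  shows "has_antipode C H m u \<Delta> \<epsilon> \<longleftrightarrow> iso C (conv_action H H m H \<Delta> (\<one> H))"
proof
  have mod: "right_module C (H, m, u) (H, m)" and comod: "left_comodule C (H, \<Delta>, \<epsilon>) (H, \<Delta>)"
    using mon comon by auto
  {
    assume "has_antipode C H m u \<Delta> \<epsilon>"
    then show "iso C (conv_action H H m H \<Delta> (\<one> H))"
      using conv_action_inverse [OF mod comod mon comon] by (auto simp: has_antipode_def conv_def)
  next
    let ?F = "conv_action H H m H \<Delta> (\<one> H)"
    assume iso [simp]: "iso C ?F"
    have H [simp]: "H \<in> Obj C" "\<one> H \<in> hom C H H"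
      and m: "m \<in> hom C (H \<otimes> H) H" and u: "u \<in> hom C \<I> H"
      and \<Delta>: "\<Delta> \<in> hom C H (H \<otimes> H)" and \<epsilon>: "\<epsilon> \<in> hom C H \<I>"
      using mon comon ident_hom by auto
    note [simp] = m [unfolded hom_iff] \<Delta> [unfolded hom_iff]
    have [simp]: "?F \<in> Arr C" "Dom C ?F = H \<otimes> H" "Cod C ?F = H \<otimes> H"
      using m \<Delta> by simp_all
    have "inv ?F \<in> hom C (H \<otimes> H) (H \<otimes> H)"
      by (simp add: hom_iff)
    moreover have "inv ?F \<cdot> (m \<boxtimes> \<one> H) = (m \<boxtimes> \<one> H) \<cdot> (inv (\<alpha> H H H) \<cdot> ((\<one> H \<boxtimes> inv ?F) \<cdot> \<alpha> H H H))"
    proof -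
      \<comment> \<open>Linearity of \<open>?F\<close> is a commuting square with two invertible
        sides; inverting these gives linearity of the inverse.\<close>
      have "inv ?F \<cdot> (m \<boxtimes> \<one> H) = (m \<boxtimes> \<one> H) \<cdot> inv (inv (\<alpha> H H H) \<cdot> ((\<one> H \<boxtimes> ?F) \<cdot> \<alpha> H H H))"
        using conv_action_left_linear [OF mon comon] by (rule inverse_square) simp_all
      then show ?thesis
        by (simp add: inv_comp inv_tensor)
    qed
    moreover have "\<alpha> H H H \<cdot> ((inv ?F \<boxtimes> \<one> H) \<cdot> inv (\<alpha> H H H)) \<cdot> (\<one> H \<boxtimes> \<Delta>) = (\<one> H \<boxtimes> \<Delta>) \<cdot> inv ?F"
    proof -
      have "inv (\<alpha> H H H \<cdot> ((?F \<boxtimes> \<one> H) \<cdot> inv (\<alpha> H H H))) \<cdot> (\<one> H \<boxtimes> \<Delta>) = (\<one> H \<boxtimes> \<Delta>) \<cdot> inv ?F"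
        using conv_action_right_colinear [OF mon comon] by (rule inverse_square) simp_all
      then show ?thesis
        by (simp add: inv_comp inv_tensor)
    qed
    ultimately obtain S where S: "S \<in> hom C H H" and inv: "inv ?F = conv_action H H m H \<Delta> S"
      using bilinear_is_conv_action [OF mon comon] by blast
    have [simp]: "S \<in> Arr C" "Dom C S = H" "Cod C S = H" "u \<cdot> \<epsilon> \<in> hom C H H"
      using S u \<epsilon> by (auto simp: hom_iff)
    have hom: "conv m \<Delta> (\<one> H) S \<in> hom C H H" "conv m \<Delta> S (\<one> H) \<in> hom C H H"
      by (simp_all add: conv_def hom_iff)
    have unit: "conv_action H H m H \<Delta> (u \<cdot> \<epsilon>) = \<one> (H \<otimes> H)"
      by (rule conv_action_unit [OF mod comod H(1) u \<epsilon>])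
    \<comment> \<open>The action of this convolution product is \<open>inv ?F \<cdot> ?F\<close>,
      the identity, which is also the action of \<open>u \<cdot> \<epsilon>\<close>.\<close>
    have "conv m \<Delta> (\<one> H) S = u \<cdot> \<epsilon>"
      by (rule conv_action_inj [OF mon comon])
        (simp_all add: hom unit conv_action_mult [OF mod comod H(1) m \<Delta> S H(2), symmetric] inv [symmetric])
    moreover have "conv m \<Delta> S (\<one> H) = u \<cdot> \<epsilon>"
      by (rule conv_action_inj [OF mon comon])
        (simp_all add: hom unit conv_action_mult [OF mod comod H(1) m \<Delta> H(2) S, symmetric] inv [symmetric])
    ultimately show "has_antipode C H m u \<Delta> \<epsilon>"
      using S by (auto simp: has_antipode_def conv_def)
  }
qed

section \<open>Fusion morphisms and Galois maps as criteria for an antipode\<close>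

text \<open>Naturality of the interchange law moves \<open>u\<close> and \<open>g\<close> past the
  braiding. There \<open>u\<close> is absorbed by the unit law in H, and \<open>g\<close> turns the
  multiplication of A into an action of H, leaving the Galois map with X = \<I>, P = A, Q =
  H.\<close>

lemma iso_fusion_lower_iff:
  assumes mon: "monoid C (H, m, u)" and comon: "comonoid C (H, \<Delta>, \<epsilon>)"
    and A: "monoid C (A, m\<^sub>A, u\<^sub>A)" and g: "monoid_hom C (H, m, u) (A, m\<^sub>A, u\<^sub>A) g"
  shows "iso C (fusion_lower C (H, m, u, \<Delta>, \<epsilon>) (A, m\<^sub>A, u\<^sub>A) g)
    \<longleftrightarrow> iso C (conv_action H A (m\<^sub>A \<cdot> (\<one> A \<boxtimes> g)) H \<Delta> (\<one> H))"
proof -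
  have [simp]: "H \<in> Obj C" "m \<in> Arr C" "Dom C m = H \<otimes> H" "Cod C m = H"
    "\<Delta> \<in> Arr C" "Dom C \<Delta> = H" "Cod C \<Delta> = H \<otimes> H" "u \<in> Arr C" "Dom C u = \<I>" "Cod C u = H"
    "A \<in> Obj C" "m\<^sub>A \<in> Arr C" "Dom C m\<^sub>A = A \<otimes> A" "Cod C m\<^sub>A = A" "g \<in> Arr C" "Dom C g = H" "Cod C g = A"
    using mon comon A g by (auto simp: hom_iff)
  have unit: "m \<cdot> (u \<boxtimes> \<one> H) = \<l> H"
    using mon by simp
  \<comment> \<open>The action of H on A obtained by restricting the regular right action of A along
    \<open>g\<close>.\<close>
  let ?\<mu> = "m\<^sub>A \<cdot> (\<one> A \<boxtimes> g)"
  let ?g = "galois_map C H (A, ?\<mu>) \<I> (H, \<Delta>)"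
  have [simp]: "?g \<in> Arr C" "Dom C ?g = (A \<otimes> \<I>) \<otimes> H" "Cod C ?g = (A \<otimes> \<I>) \<otimes> H"
    by simp_all
  have "fusion_lower C (H, m, u, \<Delta>, \<epsilon>) (A, m\<^sub>A, u\<^sub>A) g
    = (m\<^sub>A \<boxtimes> m) \<cdot> ((interchange C A H A H \<cdot> ((\<one> A \<boxtimes> u) \<boxtimes> (g \<boxtimes> \<one> H))) \<cdot> (\<one> (A \<otimes> \<I>) \<boxtimes> \<Delta>))"
    by (simp add: tensor_mult_def merge)
  also have "interchange C A H A H \<cdot> ((\<one> A \<boxtimes> u) \<boxtimes> (g \<boxtimes> \<one> H))
    = ((\<one> A \<boxtimes> g) \<boxtimes> (u \<boxtimes> \<one> H)) \<cdot> interchange C A \<I> H H"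
    using interchange_nat [of "\<one> A" u g "\<one> H"] by simp
  also have "(m\<^sub>A \<boxtimes> m) \<cdot> ((((\<one> A \<boxtimes> g) \<boxtimes> (u \<boxtimes> \<one> H)) \<cdot> interchange C A \<I> H H) \<cdot> (\<one> (A \<otimes> \<I>) \<boxtimes> \<Delta>))
    = (\<one> A \<boxtimes> \<l> H) \<cdot> (\<alpha> A \<I> H \<cdot> ?g)"
    by (simp add: merge unit)
  \<comment> \<open>The fusion morphism differs from the Galois map only by the isomorphism from (A
    \<otimes> \<I>) \<otimes> H to A \<otimes> H.\<close>
  finally have "iso C (fusion_lower C (H, m, u, \<Delta>, \<epsilon>) (A, m\<^sub>A, u\<^sub>A) g) \<longleftrightarrow> iso C ?g"
    by (simp add: iso_comp_left_iff del: galois_map.simps)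
  also have "\<dots> \<longleftrightarrow> iso C (conv_action H A ?\<mu> H \<Delta> (\<one> H) \<boxtimes> \<one> \<I>)"
    by (rule iso_galois_map_iff) (simp_all add: hom_iff)
  also have "\<dots> \<longleftrightarrow> iso C (conv_action H A ?\<mu> H \<Delta> (\<one> H))"
    by (rule iso_tensor_unit_iff) (simp add: hom_iff)
  finally show ?thesis .
qed

lemma iso_fusion_lower_ident_iff:
  assumes mon: "monoid C (H, m, u)" and comon: "comonoid C (H, \<Delta>, \<epsilon>)"
  shows "iso C (fusion_lower C (H, m, u, \<Delta>, \<epsilon>) (H, m, u) (\<one> H)) \<longleftrightarrow> has_antipode C H m u \<Delta> \<epsilon>"
proof -
  have "monoid_hom C (H, m, u) (H, m, u) (\<one> H)" "m \<cdot> (\<one> H \<boxtimes> \<one> H) = m"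
    using mon by (auto simp: hom_iff)
  then show ?thesis
    using iso_fusion_lower_iff [OF mon comon mon] has_antipode_iff_iso_conv_action [OF mon comon]
    by simp
qed

text \<open>An antipode makes the action of the identity invertible for every module, in particular
  for A restricted along \<open>g\<close>; conversely, the case of the identity of H is
  enough.\<close>

lemma has_antipode_iff_fusion_lower:
  assumes mon: "monoid C (H, m, u)" and comon: "comonoid C (H, \<Delta>, \<epsilon>)"
  shows "has_antipode C H m u \<Delta> \<epsilon> \<longleftrightarrow>
    (\<forall>A m\<^sub>A u\<^sub>A g. monoid C (A, m\<^sub>A, u\<^sub>A) \<longrightarrow> monoid_hom C (H, m, u) (A, m\<^sub>A, u\<^sub>A) g \<longrightarrow>
      iso C (fusion_lower C (H, m, u, \<Delta>, \<epsilon>) (A, m\<^sub>A, u\<^sub>A) g))" (is "_ \<longleftrightarrow> ?fusion")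
proof
  assume "has_antipode C H m u \<Delta> \<epsilon>"
  then obtain S where S: "S \<in> hom C H H" "conv m \<Delta> (\<one> H) S = u \<cdot> \<epsilon>" "conv m \<Delta> S (\<one> H) = u \<cdot> \<epsilon>"
    by (auto simp: has_antipode_def conv_def)
  have comod: "left_comodule C (H, \<Delta>, \<epsilon>) (H, \<Delta>)"
    using comon by simp
  show ?fusion
  proof (intro allI impI)
    fix A m\<^sub>A u\<^sub>A g
    assume A: "monoid C (A, m\<^sub>A, u\<^sub>A)" and g: "monoid_hom C (H, m, u) (A, m\<^sub>A, u\<^sub>A) g"
    have [simp]: "H \<in> Obj C" "m \<in> Arr C" "Dom C m = H \<otimes> H" "Cod C m = H"
      "u \<in> Arr C" "Dom C u = \<I>" "Cod C u = H"
      "A \<in> Obj C" "m\<^sub>A \<in> Arr C" "Dom C m\<^sub>A = A \<otimes> A" "Cod C m\<^sub>A = A" "g \<in> Arr C" "Dom C g = H" "Cod C g = A"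
      using mon A g by (auto simp: hom_iff)
    have assoc_A: "m\<^sub>A \<cdot> (m\<^sub>A \<boxtimes> \<one> A) = m\<^sub>A \<cdot> ((\<one> A \<boxtimes> m\<^sub>A) \<cdot> \<alpha> A A A)"
      and unit_A: "m\<^sub>A \<cdot> (\<one> A \<boxtimes> u\<^sub>A) = \<r> A"
      and g_mult: "g \<cdot> m = m\<^sub>A \<cdot> (g \<boxtimes> g)" and g_unit: "g \<cdot> u = u\<^sub>A"
      using A g by auto
    let ?\<mu> = "m\<^sub>A \<cdot> (\<one> A \<boxtimes> g)"
    \<comment> \<open>Restriction along a monoid morphism gives a module: associativity in A, then
      multiplicativity of \<open>g\<close>.\<close>
    have "?\<mu> \<cdot> (?\<mu> \<boxtimes> \<one> H) = (m\<^sub>A \<cdot> (m\<^sub>A \<boxtimes> \<one> A)) \<cdot> ((\<one> A \<boxtimes> g) \<boxtimes> g)"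
      by (simp add: merge)
    also have "\<dots> = (m\<^sub>A \<cdot> (\<one> A \<boxtimes> m\<^sub>A)) \<cdot> (\<alpha> A A A \<cdot> ((\<one> A \<boxtimes> g) \<boxtimes> g))"
      unfolding assoc_A by simp
    also have "\<alpha> A A A \<cdot> ((\<one> A \<boxtimes> g) \<boxtimes> g) = (\<one> A \<boxtimes> (g \<boxtimes> g)) \<cdot> \<alpha> A H H"
      using associator_nat [of "\<one> A" g g] by simp
    also have "(m\<^sub>A \<cdot> (\<one> A \<boxtimes> m\<^sub>A)) \<cdot> \<dots> = ?\<mu> \<cdot> (\<one> A \<boxtimes> m) \<cdot> \<alpha> A H H"
      by (simp add: merge g_mult)
    finally have "right_module C (H, m, u) (A, ?\<mu>)"
      by (simp add: hom_iff interchange_law g_unit unit_A)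
    then show "iso C (fusion_lower C (H, m, u, \<Delta>, \<epsilon>) (A, m\<^sub>A, u\<^sub>A) g)"
      using conv_action_inverse [OF _ comod mon comon S] iso_fusion_lower_iff [OF mon comon A g]
      by blast
  qed
next
  assume ?fusion
  moreover have "monoid_hom C (H, m, u) (H, m, u) (\<one> H)"
    using mon by (auto simp: hom_iff)
  ultimately show "has_antipode C H m u \<Delta> \<epsilon>"
    using mon iso_fusion_lower_ident_iff [OF mon comon] by blast
qed

lemma has_antipode_iff_galois:
  assumes mon: "monoid C (H, m, u)" and comon: "comonoid C (H, \<Delta>, \<epsilon>)"
  shows "has_antipode C H m u \<Delta> \<epsilon> \<longleftrightarrow>
    (\<forall>X P \<mu> Q \<rho>. X \<in> Obj C \<longrightarrow> right_module C (H, m, u) (P, \<mu>) \<longrightarrow> left_comodule C (H, \<Delta>, \<epsilon>) (Q, \<rho>) \<longrightarrow>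
      iso C (galois_map C H (P, \<mu>) X (Q, \<rho>)))" (is "_ \<longleftrightarrow> ?galois")
proof
  have H: "H \<in> Obj C"
    using mon by simp
  {
    assume "has_antipode C H m u \<Delta> \<epsilon>"
    then obtain S where S: "S \<in> hom C H H" "conv m \<Delta> (\<one> H) S = u \<cdot> \<epsilon>" "conv m \<Delta> S (\<one> H) = u \<cdot> \<epsilon>"
      by (auto simp: has_antipode_def conv_def)
    show ?galois
    proof (intro allI impI)
      fix X P \<mu> Q \<rho>
      assume X: "X \<in> Obj C" and mod: "right_module C (H, m, u) (P, \<mu>)"
        and comod: "left_comodule C (H, \<Delta>, \<epsilon>) (Q, \<rho>)"
      from mod comod have "P \<in> Obj C" "Q \<in> Obj C" "\<mu> \<in> hom C (P \<otimes> H) P" "\<rho> \<in> hom C Q (H \<otimes> Q)"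
        by auto
      with X show "iso C (galois_map C H (P, \<mu>) X (Q, \<rho>))"
        using iso_galois_map_iff [OF H] conv_action_inverse [OF mod comod mon comon S]
        by (simp del: galois_map.simps)
    qed
  next
    assume ?galois
    \<comment> \<open>The regular module and the regular comodule, with X = \<I>, give back the
      fusion case.\<close>
    moreover have "right_module C (H, m, u) (H, m)" "left_comodule C (H, \<Delta>, \<epsilon>) (H, \<Delta>)"
      using mon comon by auto
    ultimately have "iso C (galois_map C H (H, m) \<I> (H, \<Delta>))"
      using unit_Obj by blast
    moreover have "m \<in> hom C (H \<otimes> H) H" "\<Delta> \<in> hom C H (H \<otimes> H)" "\<one> H \<in> hom C H H"
      using mon comon ident_hom by auto
    ultimately show "has_antipode C H m u \<Delta> \<epsilon>"
      using H has_antipode_iff_iso_conv_action [OF mon comon]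
      by (simp add: iso_galois_map_iff iso_tensor_unit_iff del: galois_map.simps)
  }
qed

end

section \<open>Duality\<close>

text \<open>Arrows are reversed and the order of tensor factors is kept. The constraints must
  therefore be inverted, while the braiding has its indices exchanged: \<open>\<sigma> B A\<close>,
  read backwards, runs from A \<otimes> B to B \<otimes> A.\<close>

definition opposite :: "('o, 'a) braidcat \<Rightarrow> ('o, 'a) braidcat"
  where "opposite C = \<lparr>Obj = Obj C, Arr = Arr C, Dom = Cod C, Cod = Dom C, ident = ident C,
    comp = (\<lambda>g f. comp C f g), tensor_obj = tensor_obj C, tensor_arr = tensor_arr C,
    unit_obj = unit_obj C, associator = (\<lambda>A B D. inv_arr C (associator C A B D)),
    lunit = (\<lambda>A. inv_arr C (lunit C A)), runit = (\<lambda>A. inv_arr C (runit C A)),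
    braiding = (\<lambda>A B. braiding C B A)\<rparr>"

lemma opposite_simps [simp]:
  "Obj (opposite C) = Obj C" "Arr (opposite C) = Arr C" "Dom (opposite C) = Cod C"
  "Cod (opposite C) = Dom C" "ident (opposite C) = ident C" "comp (opposite C) g f = comp C f g"
  "tensor_obj (opposite C) = tensor_obj C" "tensor_arr (opposite C) = tensor_arr C"
  "unit_obj (opposite C) = unit_obj C"
  "associator (opposite C) A B D = inv_arr C (associator C A B D)"
  "lunit (opposite C) A = inv_arr C (lunit C A)" "runit (opposite C) A = inv_arr C (runit C A)"
  "braiding (opposite C) A B = braiding C B A"
  by (simp_all add: opposite_def)

lemma hom_opposite [simp]: "hom (opposite C) A B = hom C B A"
  by (auto simp: hom_def)

lemma inverse_arrows_opposite: "inverse_arrows (opposite C) f g \<longleftrightarrow> inverse_arrows C f g"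
  by (auto simp: inverse_arrows_def)

lemma iso_opposite [simp]: "iso (opposite C) f \<longleftrightarrow> iso C f"
  and inv_arr_opposite [simp]: "inv_arr (opposite C) f = inv_arr C f"
  by (simp_all add: iso_def inv_arr_def inverse_arrows_opposite)

text \<open>Pentagon and triangle turn into their inverted forms, and the two hexagons are exchanged
  with each other.\<close>

lemma (in braided_monoidal_category) braided_opposite:
  "braided_monoidal_category (opposite C)"
proof -
  have triangle_inverse: "inv (\<alpha> A \<I> B) \<cdot> (\<one> A \<boxtimes> inv (\<l> B)) = inv (\<r> A) \<boxtimes> \<one> B"
    if "A \<in> Obj C" "B \<in> Obj C" for A B
    using that by (simp flip: triangle_inverse_mixed)
  have hexagon1': "\<alpha> B D A \<cdot> (\<sigma> A (B \<otimes> D) \<cdot> \<alpha> A B D) = (\<one> B \<boxtimes> \<sigma> A D) \<cdot> (\<alpha> B A D \<cdot> (\<sigma> A B \<boxtimes> \<one> D))"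
    if "A \<in> Obj C" "B \<in> Obj C" "D \<in> Obj C" for A B D
    using hexagon1 [OF that] that by simp
  have hexagon2': "inv (\<alpha> D A B) \<cdot> (\<sigma> (A \<otimes> B) D \<cdot> inv (\<alpha> A B D))
        = (\<sigma> A D \<boxtimes> \<one> B) \<cdot> (inv (\<alpha> A D B) \<cdot> (\<one> A \<boxtimes> \<sigma> B D))"
    if "A \<in> Obj C" "B \<in> Obj C" "D \<in> Obj C" for A B D
    using hexagon2 [OF that] that by simp
  show ?thesis
    by (unfold_locales, simp_all only: opposite_simps hom_opposite iso_opposite inv_arr_opposite)
      (auto simp: hom_iff interchange_law associator_inv_nat lunit_inv_nat runit_inv_nat braiding_nat
        pentagon_inverse triangle_inverse hexagon1' hexagon2')
qed

context braided_monoidal_category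
begin

section \<open>Structures in the opposite category\<close>

lemma interchange_opposite:
  assumes "A \<in> Obj C" "B \<in> Obj C" "D \<in> Obj C" "E \<in> Obj C"
  shows "interchange (opposite C) A B D E = interchange C A D B E"
  using assms by (simp add: interchange_def)

text \<open>The laws correspond one by one. The opposite associator is an inverse, so the
  associativity law arrives with the associator on the other side and has to be moved
  across.\<close>

lemma monoid_opposite: "monoid (opposite C) (A, m, u) \<longleftrightarrow> comonoid C (A, m, u)"
proof (cases "A \<in> Obj C \<and> m \<in> hom C A (A \<otimes> A) \<and> u \<in> hom C A \<I>")
  case True
  then have [simp]: "A \<in> Obj C" "m \<in> Arr C" "Dom C m = A" "Cod C m = A \<otimes> A"
    "u \<in> Arr C" "Dom C u = A" "Cod C u = \<I>"
    by (auto simp: hom_iff)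
  show ?thesis
    by (auto simp: hom_iff inv_comp_eq_iff)
qed auto

lemma comonoid_opposite: "comonoid (opposite C) (A, \<Delta>, \<epsilon>) \<longleftrightarrow> monoid C (A, \<Delta>, \<epsilon>)"
proof (cases "A \<in> Obj C \<and> \<Delta> \<in> hom C (A \<otimes> A) A \<and> \<epsilon> \<in> hom C \<I> A")
  case True
  then have [simp]: "A \<in> Obj C" "\<Delta> \<in> Arr C" "Dom C \<Delta> = A \<otimes> A" "Cod C \<Delta> = A"
    "\<epsilon> \<in> Arr C" "Dom C \<epsilon> = \<I>" "Cod C \<epsilon> = A"
    by (auto simp: hom_iff)
  have "(\<Delta> \<cdot> ((\<Delta> \<boxtimes> \<one> A) \<cdot> inv (\<alpha> A A A)) = \<Delta> \<cdot> (\<one> A \<boxtimes> \<Delta>)) \<longleftrightarrow> 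
     (\<Delta> \<cdot> (\<Delta> \<boxtimes> \<one> A) = \<Delta> \<cdot> (\<one> A \<boxtimes> \<Delta>) \<cdot> \<alpha> A A A)"
    using comp_inv_eq_iff [of "\<alpha> A A A" "\<Delta> \<cdot> (\<one> A \<boxtimes> \<Delta>)" "\<Delta> \<cdot> (\<Delta> \<boxtimes> \<one> A)"] by simp
  then show ?thesis
    by (simp add: hom_iff)
qed auto

lemma right_module_opposite:
  "right_module (opposite C) (H, \<Delta>, \<epsilon>) (P, \<rho>) \<longleftrightarrow> right_comodule C (H, \<Delta>, \<epsilon>) (P, \<rho>)"
  if "\<Delta> \<in> hom C H (H \<otimes> H)" "\<epsilon> \<in> hom C H \<I>" "H \<in> Obj C"
proof (cases "P \<in> Obj C \<and> \<rho> \<in> hom C P (P \<otimes> H)")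
  case True
  with that have [simp]: "P \<in> Obj C" "\<rho> \<in> Arr C" "Dom C \<rho> = P" "Cod C \<rho> = P \<otimes> H" "H \<in> Obj C"
    "\<Delta> \<in> Arr C" "Dom C \<Delta> = H" "Cod C \<Delta> = H \<otimes> H" "\<epsilon> \<in> Arr C" "Dom C \<epsilon> = H" "Cod C \<epsilon> = \<I>"
    by (auto simp: hom_iff)
  show ?thesis
    by (auto simp: hom_iff inv_comp_eq_iff)
qed auto

lemma left_comodule_opposite:
  "left_comodule (opposite C) (H, m, u) (Q, \<mu>) \<longleftrightarrow> left_module C (H, m, u) (Q, \<mu>)"
  if "m \<in> hom C (H \<otimes> H) H" "u \<in> hom C \<I> H" "H \<in> Obj C"
proof (cases "Q \<in> Obj C \<and> \<mu> \<in> hom C (H \<otimes> Q) Q")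
  case True
  with that have [simp]: "Q \<in> Obj C" "\<mu> \<in> Arr C" "Dom C \<mu> = H \<otimes> Q" "Cod C \<mu> = Q" "H \<in> Obj C"
    "m \<in> Arr C" "Dom C m = H \<otimes> H" "Cod C m = H" "u \<in> Arr C" "Dom C u = \<I>" "Cod C u = H"
    by (auto simp: hom_iff)
  have "(\<mu> \<cdot> ((m \<boxtimes> \<one> Q) \<cdot> inv (\<alpha> H H Q)) = \<mu> \<cdot> (\<one> H \<boxtimes> \<mu>)) \<longleftrightarrow> 
     (\<mu> \<cdot> (m \<boxtimes> \<one> Q) = \<mu> \<cdot> (\<one> H \<boxtimes> \<mu>) \<cdot> \<alpha> H H Q)"
    using comp_inv_eq_iff [of "\<alpha> H H Q" "\<mu> \<cdot> (\<one> H \<boxtimes> \<mu>)" "\<mu> \<cdot> (m \<boxtimes> \<one> Q)"] by simp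
  then show ?thesis
    by (simp add: hom_iff)
qed auto

lemma monoid_hom_opposite:
  "monoid_hom (opposite C) (H, \<Delta>, \<epsilon>) (D, \<Delta>', \<epsilon>') g \<longleftrightarrow> comonoid_hom C (D, \<Delta>', \<epsilon>') (H, \<Delta>, \<epsilon>) g"
  by auto

text \<open>Each antipode equation is carried to itself up to rebracketing, so the same S serves on
  both sides.\<close>

lemma has_antipode_opposite:
  assumes "H \<in> Obj C" "m \<in> hom C (H \<otimes> H) H" "\<Delta> \<in> hom C H (H \<otimes> H)"
  shows "has_antipode (opposite C) H \<Delta> \<epsilon> m u \<longleftrightarrow> has_antipode C H m u \<Delta> \<epsilon>"
  using assms by (auto simp: has_antipode_def hom_iff intro!: bex_cong)

text \<open>The co-Galois map and the opposite Galois map share a core from P \<otimes> (X \<otimes>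
  Q) to (P \<otimes> X) \<otimes> Q. They differ in the side on which the associator is composed to
  make it an endomorphism, so they need not be equal but are invertible together.\<close>

lemma iso_cogalois_map_iff:
  assumes [simp]: "H \<in> Obj C" "P \<in> Obj C" "X \<in> Obj C" "Q \<in> Obj C"
    and \<mu>: "\<mu> \<in> hom C (H \<otimes> Q) Q" and \<rho>: "\<rho> \<in> hom C P (P \<otimes> H)"
  shows "iso C (cogalois_map C H (P, \<rho>) X (Q, \<mu>))
    \<longleftrightarrow> iso (opposite C) (galois_map (opposite C) H (P, \<rho>) X (Q, \<mu>))"
proof -
  have [simp]: "\<mu> \<in> Arr C" "Dom C \<mu> = H \<otimes> Q" "Cod C \<mu> = Q" "\<rho> \<in> Arr C" "Dom C \<rho> = P" "Cod C \<rho> = P \<otimes> H"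
    using \<mu> \<rho> by (auto simp: hom_iff)
  let ?f = "(\<one> (P \<otimes> X) \<boxtimes> \<mu>) \<cdot> (interchange C P H X Q \<cdot> (\<rho> \<boxtimes> \<one> (X \<otimes> Q)))"
  have "galois_map (opposite C) H (P, \<rho>) X (Q, \<mu>) = ?f \<cdot> \<alpha> P X Q"
    "cogalois_map C H (P, \<rho>) X (Q, \<mu>) = \<alpha> P X Q \<cdot> ?f"
    by (simp_all add: interchange_opposite)
  then show ?thesis
    by (simp add: iso_comp_left_iff iso_comp_right_iff del: assoc galois_map.simps cogalois_map.simps)
qed

text \<open>Here duality holds on the nose: reversal exchanges the middle indices of the interchange
  law, which turns \<open>tensor_mult\<close> into \<open>tensor_comult\<close>.\<close>

lemma fusion_lower_opposite:
  assumes "H \<in> Obj C" "D \<in> Obj C"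
  shows "fusion_lower (opposite C) (H, \<Delta>, \<epsilon>, m, u) (D, \<Delta>\<^sub>D, \<epsilon>\<^sub>D) g
    = fusion_upper C (H, m, u, \<Delta>, \<epsilon>) (D, \<Delta>\<^sub>D, \<epsilon>\<^sub>D) g"
  using assms by (simp add: tensor_mult_def tensor_comult_def interchange_opposite)

section \<open>The dual criteria\<close>

text \<open>The Galois criterion read in the opposite category, where the comultiplication of H is
  the multiplication and right modules are right comodules.\<close>

lemma has_antipode_iff_cogalois:
  assumes mon: "monoid C (H, m, u)" and comon: "comonoid C (H, \<Delta>, \<epsilon>)"
  shows "has_antipode C H m u \<Delta> \<epsilon> \<longleftrightarrow>
    (\<forall>X P \<rho> Q \<mu>. X \<in> Obj C \<longrightarrow> right_comodule C (H, \<Delta>, \<epsilon>) (P, \<rho>) \<longrightarrow> left_module C (H, m, u) (Q, \<mu>) \<longrightarrow>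
      iso C (cogalois_map C H (P, \<rho>) X (Q, \<mu>)))"
proof -
  have H: "H \<in> Obj C" "m \<in> hom C (H \<otimes> H) H" "u \<in> hom C \<I> H" "\<Delta> \<in> hom C H (H \<otimes> H)" "\<epsilon> \<in> hom C H \<I>"
    using mon comon by auto
  have "has_antipode C H m u \<Delta> \<epsilon> \<longleftrightarrow>
    (\<forall>X P \<rho> Q \<mu>. X \<in> Obj C \<longrightarrow> right_comodule C (H, \<Delta>, \<epsilon>) (P, \<rho>) \<longrightarrow> left_module C (H, m, u) (Q, \<mu>) \<longrightarrow>
      iso (opposite C) (galois_map (opposite C) H (P, \<rho>) X (Q, \<mu>)))"
    using braided_monoidal_category.has_antipode_iff_galois [OF braided_opposite, of H \<Delta> \<epsilon> m u]
    by (simp only: has_antipode_opposite [OF H(1,2,4)] monoid_opposite comonoid_opposite mon comon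
        right_module_opposite [OF H(4,5,1)] left_comodule_opposite [OF H(2,3,1)] opposite_simps simp_thms)
  moreover have "iso (opposite C) (galois_map (opposite C) H (P, \<rho>) X (Q, \<mu>))
      \<longleftrightarrow> iso C (cogalois_map C H (P, \<rho>) X (Q, \<mu>))"
    if "X \<in> Obj C" "right_comodule C (H, \<Delta>, \<epsilon>) (P, \<rho>)" "left_module C (H, m, u) (Q, \<mu>)" for X P \<rho> Q \<mu>
    using that by (intro iso_cogalois_map_iff [OF H(1), symmetric]) auto
  ultimately show ?thesis
    by blast
qed

lemma has_antipode_iff_fusion_upper:
  assumes mon: "monoid C (H, m, u)" and comon: "comonoid C (H, \<Delta>, \<epsilon>)"
  shows "has_antipode C H m u \<Delta> \<epsilon> \<longleftrightarrow>
    (\<forall>D \<Delta>\<^sub>D \<epsilon>\<^sub>D g. comonoid C (D, \<Delta>\<^sub>D, \<epsilon>\<^sub>D) \<longrightarrow> comonoid_hom C (D, \<Delta>\<^sub>D, \<epsilon>\<^sub>D) (H, \<Delta>, \<epsilon>) g \<longrightarrow>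
      iso C (fusion_upper C (H, m, u, \<Delta>, \<epsilon>) (D, \<Delta>\<^sub>D, \<epsilon>\<^sub>D) g))"
proof -
  have H: "H \<in> Obj C" "m \<in> hom C (H \<otimes> H) H" "\<Delta> \<in> hom C H (H \<otimes> H)"
    using mon comon by auto
  have "has_antipode C H m u \<Delta> \<epsilon> \<longleftrightarrow>
    (\<forall>D \<Delta>\<^sub>D \<epsilon>\<^sub>D g. comonoid C (D, \<Delta>\<^sub>D, \<epsilon>\<^sub>D) \<longrightarrow> comonoid_hom C (D, \<Delta>\<^sub>D, \<epsilon>\<^sub>D) (H, \<Delta>, \<epsilon>) g \<longrightarrow>
      iso C (fusion_lower (opposite C) (H, \<Delta>, \<epsilon>, m, u) (D, \<Delta>\<^sub>D, \<epsilon>\<^sub>D) g))"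
    using braided_monoidal_category.has_antipode_iff_fusion_lower [OF braided_opposite, of H \<Delta> \<epsilon> m u]
    by (simp only: has_antipode_opposite [OF H] monoid_opposite comonoid_opposite mon comon
        monoid_hom_opposite iso_opposite simp_thms)
  moreover have "D \<in> Obj C" if "comonoid C (D, \<Delta>\<^sub>D, \<epsilon>\<^sub>D)" for D \<Delta>\<^sub>D \<epsilon>\<^sub>D
    using that by simp
  ultimately show ?thesis
    using fusion_lower_opposite [OF H(1)] by metis
qed

lemma iso_fusion_upper_ident_iff:
  assumes mon: "monoid C (H, m, u)" and comon: "comonoid C (H, \<Delta>, \<epsilon>)"
  shows "iso C (fusion_upper C (H, m, u, \<Delta>, \<epsilon>) (H, \<Delta>, \<epsilon>) (\<one> H)) \<longleftrightarrow> has_antipode C H m u \<Delta> \<epsilon>"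
proof -
  have H: "H \<in> Obj C" "m \<in> hom C (H \<otimes> H) H" "\<Delta> \<in> hom C H (H \<otimes> H)"
    using mon comon by auto
  show ?thesis
    using braided_monoidal_category.iso_fusion_lower_ident_iff [OF braided_opposite, of H \<Delta> \<epsilon> m u]
    by (simp only: has_antipode_opposite [OF H] monoid_opposite comonoid_opposite mon comon
        iso_opposite opposite_simps fusion_lower_opposite [OF H(1) H(1)] simp_thms)
qed

end

section \<open>Assembly of the equivalences\<close>

theorem proposition4p2:
  fixes C :: "('o, 'a) braidcat"
  assumes "braided_monoidal_category C"
  shows "(\<forall>H m u \<Delta> \<epsilon>. bimonoid C (H, m, u, \<Delta>, \<epsilon>) \<longrightarrow>
      (hopf_monoid_braided C (H, m, u, \<Delta>, \<epsilon>)
        \<longleftrightarrow> hopf_monoid_duoidal C (H, m, u, \<Delta>, \<epsilon>)) \<and>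
      (hopf_monoid_braided C (H, m, u, \<Delta>, \<epsilon>)
        \<longleftrightarrow> (\<forall>X P \<mu> Q \<rho>. X \<in> Obj C \<longrightarrow>
              right_module C (H, m, u) (P, \<mu>) \<longrightarrow> left_comodule C (H, \<Delta>, \<epsilon>) (Q, \<rho>) \<longrightarrow>
              iso C (galois_map C H (P, \<mu>) X (Q, \<rho>)))) \<and>
      (hopf_monoid_braided C (H, m, u, \<Delta>, \<epsilon>)
        \<longleftrightarrow> (\<forall>X P \<rho> Q \<mu>. X \<in> Obj C \<longrightarrow>
              right_comodule C (H, \<Delta>, \<epsilon>) (P, \<rho>) \<longrightarrow> left_module C (H, m, u) (Q, \<mu>) \<longrightarrow>
              iso C (cogalois_map C H (P, \<rho>) X (Q, \<mu>)))) \<and>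
      (hopf_monoid_braided C (H, m, u, \<Delta>, \<epsilon>)
        \<longleftrightarrow> (\<forall>A m\<^sub>A u\<^sub>A g. monoid C (A, m\<^sub>A, u\<^sub>A) \<longrightarrow>
              monoid_hom C (H, m, u) (A, m\<^sub>A, u\<^sub>A) g \<longrightarrow>
              iso C (fusion_lower C (H, m, u, \<Delta>, \<epsilon>) (A, m\<^sub>A, u\<^sub>A) g))) \<and>
      (hopf_monoid_braided C (H, m, u, \<Delta>, \<epsilon>)
        \<longleftrightarrow> (\<forall>D \<Delta>\<^sub>D \<epsilon>\<^sub>D g. comonoid C (D, \<Delta>\<^sub>D, \<epsilon>\<^sub>D) \<longrightarrow>
              comonoid_hom C (D, \<Delta>\<^sub>D, \<epsilon>\<^sub>D) (H, \<Delta>, \<epsilon>) g \<longrightarrow>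
              iso C (fusion_upper C (H, m, u, \<Delta>, \<epsilon>) (D, \<Delta>\<^sub>D, \<epsilon>\<^sub>D) g))) \<and>
      (hopf_monoid_braided C (H, m, u, \<Delta>, \<epsilon>)
        \<longleftrightarrow> iso C (fusion_lower C (H, m, u, \<Delta>, \<epsilon>) (H, m, u) (ident C H))) \<and>
      (hopf_monoid_braided C (H, m, u, \<Delta>, \<epsilon>)
        \<longleftrightarrow> iso C (fusion_upper C (H, m, u, \<Delta>, \<epsilon>) (H, \<Delta>, \<epsilon>) (ident C H)))) \<and>
    Hopf_duoidal C = Hopf_braided C"
    (is "(\<forall>H m u \<Delta> \<epsilon>. _ \<longrightarrow> ?conditions H m u \<Delta> \<epsilon>) \<and> _")
proof -
  interpret braided_monoidal_category C
    by fact
  \<comment> \<open>Both predicates include the bimonoid axioms, so they agree on every tuple. The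
    two full subcategories are therefore equal, and not merely isomorphic.\<close>
  have "hopf_monoid_braided C (H, m, u, \<Delta>, \<epsilon>) \<longleftrightarrow> hopf_monoid_duoidal C (H, m, u, \<Delta>, \<epsilon>)"
    for H m u \<Delta> \<epsilon>
    using hopf_monoid_braided_iff hopf_monoid_duoidal_iff
    by (metis hopf_monoid_braided.simps hopf_monoid_duoidal.simps)
  then have "hopf_monoid_duoidal C = hopf_monoid_braided C"
    by (intro ext) (auto simp del: hopf_monoid_braided.simps hopf_monoid_duoidal.simps)
  then have "Hopf_duoidal C = Hopf_braided C"
    by (simp add: Hopf_duoidal_def Hopf_braided_def)
  then show ?thesis
  \<comment> \<open>Fixing \<open>Q\<close> splits only the outermost conjunction, which keeps the
    equivalences together for a common rewriting.\<close>
  proof (intro conjI [where Q = "Hopf_duoidal C = Hopf_braided C"] allI impI)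
    fix H m u \<Delta> \<epsilon>
    assume bimon: "bimonoid C (H, m, u, \<Delta>, \<epsilon>)"
    then have mon: "monoid C (H, m, u)" and comon: "comonoid C (H, \<Delta>, \<epsilon>)"
      by (simp_all only: bimonoid.simps)
    show "?conditions H m u \<Delta> \<epsilon>"
      \<comment> \<open>Both Hopf conditions and both fusion conditions for the identity become
        \<open>has_antipode\<close>; the four quantified conditions are then the criteria proved
        above.\<close>
      unfolding hopf_monoid_braided_iff [OF bimon] hopf_monoid_duoidal_iff [OF bimon]
        iso_fusion_lower_ident_iff [OF mon comon] iso_fusion_upper_ident_iff [OF mon comon]
      by (intro conjI refl has_antipode_iff_galois has_antipode_iff_cogalois
          has_antipode_iff_fusion_lower has_antipode_iff_fusion_upper mon comon)
  qed
qed

end
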